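(* Let $u,v$ be independent, each uniformly distributed on $\mathcal G_n$. As $n\to\infty$, \[\mathbb E[\mathrm{FS}(u,v)]=\frac32 n-\frac{1}{2\sqrt\pi}\sqrt n-2+o(1),\] and, with $Z_1,Z_2$ independent standard normal random variables, \[\frac{\mathrm{FS}(u,v)-\frac32 n}{\sqrt n}\xrightarrow{d}-\frac12\max(Z_1,Z_2).\]
   Context: $\mathcal G_n$ is the set of Grassmannian permutations in $S_n$: those $w$ with at most one index $m\in\{1,\dots,n-1\}$ such that $w(m)>w(m+1)$. Let $S_{\mathbb Z_+}$ be the group of permutations of the positive integers fixing all but finitely many points; $S_n\subset S_{\mathbb Z_+}$ by letting $w\in S_n$ fix every $j>n$. For $w\in S_{\mathbb Z_+}$ let $\mathrm{FS}(w)=\min\{n\ge1: w\in S_n\}$. For $j\ge1$ let $\chi_j(w)=1$ if there exists $k<j$ with $w(k)>w(j)$ and $\chi_j(w)=0$ otherwise, and $\Lambda_i(w)=\sum_{j\ge i}\chi_j(w)$. For $u,v\in S_{\mathbb Z_+}$, $\mathrm{FS}(u,v)$ is the smallest $m$ such that every $w$ with nonzero Schubert structure constant $c^w_{u,v}$ (where $\mathfrak S_u\mathfrak S_v=\sum_w c^w_{u,v}\mathfrak S_w$) lies in $S_m$. It is known (Hardt–Wallach) that $\mathrm{FS}(u,v)=\max_{1\le i\le 1+\max(\mathrm{FS}(u),\mathrm{FS}(v))}(\Lambda_i(u)+\Lambda_i(v)+i-1)$. $\xrightarrow{d}$ denotes convergence in distribution. *)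

theory Defs
  imports
    "HOL-Probability.Probability"
    "HOL-Library.Poly_Mapping"
    "HOL-Combinatorics.Combinatorics"
begin

subsection \<open>Permutations\<close>

text \<open>Permutations of the positive integers are functions on \<^typ>\<open>nat\<close> that fix \<open>0\<close>;
  the finite symmetric group \<open>S\<^sub>n\<close> is the set of all \<open>w\<close> with \<open>w permutes {1..n}\<close>.\<close>

definition S_inf :: "(nat \<Rightarrow> nat) set" where
  "S_inf = {w. \<exists>n. w permutes {1..n}}"

definition grassmannian_perms :: "nat \<Rightarrow> (nat \<Rightarrow> nat) set" where
  "grassmannian_perms n =
     {w. w permutes {1..n} \<and> card {m \<in> {1..<n}. w m > w (Suc m)} \<le> 1}"

definition longest_perm :: "nat \<Rightarrow> nat \<Rightarrow> nat" where
  "longest_perm n j = (if j \<in> {1..n} then n + 1 - j else j)"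

subsection \<open>Polynomials and divided differences\<close>

text \<open>Integer polynomials in \<open>x\<^sub>0, x\<^sub>1, x\<^sub>2, \<dots>\<close>, as finitely supported functions on exponent
  vectors. The variable \<open>x\<^sub>0\<close> never occurs in a Schubert polynomial.\<close>

type_synonym ipoly = "(nat \<Rightarrow>\<^sub>0 nat) \<Rightarrow>\<^sub>0 int"

definition var :: "nat \<Rightarrow> ipoly" where
  "var i = Poly_Mapping.single (Poly_Mapping.single i 1) 1"

text \<open>The action of \<open>s\<^sub>i\<close>: exchange \<open>x\<^sub>i\<close> and \<open>x\<^sub>i\<^sub>+\<^sub>1\<close>. The inner \<open>map_key\<close> permutes the entries of an
  exponent vector, the outer one applies this to all monomials.\<close>

definition swap_vars :: "nat \<Rightarrow> ipoly \<Rightarrow> ipoly" where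
  "swap_vars i f = Poly_Mapping.map_key (Poly_Mapping.map_key (Transposition.transpose i (Suc i))) f"

text \<open>\<open>\<partial>\<^sub>i f = (f - s\<^sub>i f) / (x\<^sub>i - x\<^sub>i\<^sub>+\<^sub>1)\<close>; the division is exact.\<close>

definition divided_difference :: "nat \<Rightarrow> ipoly \<Rightarrow> ipoly" where
  "divided_difference i f = (THE g. (var i - var (Suc i)) * g = f - swap_vars i f)"

subsection \<open>Schubert polynomials\<close>

text \<open>The definition of Lascoux and Schuetzenberger. The relation contains the descending recursions
  from the longest element of every \<open>S\<^sub>n\<close> simultaneously; they agree, by the braid relations for
  divided differences and the stability of Schubert polynomials.\<close>

inductive is_schubert :: "(nat \<Rightarrow> nat) \<Rightarrow> ipoly \<Rightarrow> bool" where
  longest: "is_schubert (longest_perm n) (\<Prod>i\<in>{1..n}. var i ^ (n - i))"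
| descent: "is_schubert w f \<Longrightarrow> i \<ge> 1 \<Longrightarrow> w i > w (Suc i) \<Longrightarrow>
    is_schubert (w \<circ> Transposition.transpose i (Suc i)) (divided_difference i f)"

definition schubert :: "(nat \<Rightarrow> nat) \<Rightarrow> ipoly" where
  "schubert w = (THE f. is_schubert w f)"

text \<open>\<open>schubert_coeff u v w\<close> is the structure constant \<open>c\<^sup>w\<^sub>u\<^sub>,\<^sub>v\<close>. The expansion exists and is unique
  because the Schubert polynomials form a basis of the polynomials in \<open>x\<^sub>1, x\<^sub>2, \<dots>\<close>.\<close>

definition schubert_coeff :: "(nat \<Rightarrow> nat) \<Rightarrow> (nat \<Rightarrow> nat) \<Rightarrow> (nat \<Rightarrow> nat) \<Rightarrow> int" where
  "schubert_coeff u v =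
     (THE c. finite {w. c w \<noteq> 0} \<and> {w. c w \<noteq> 0} \<subseteq> S_inf \<and>
        schubert u * schubert v = (\<Sum>w | c w \<noteq> 0. of_int (c w) * schubert w))"

definition FS :: "(nat \<Rightarrow> nat) \<Rightarrow> (nat \<Rightarrow> nat) \<Rightarrow> nat" where
  "FS u v = (LEAST m. m \<ge> 1 \<and> (\<forall>w \<in> S_inf. schubert_coeff u v w \<noteq> 0 \<longrightarrow> w permutes {1..m}))"

subsection \<open>The random pair\<close>

definition grassmannian_pair :: "nat \<Rightarrow> ((nat \<Rightarrow> nat) \<times> (nat \<Rightarrow> nat)) pmf" where
  "grassmannian_pair n =
     pair_pmf (pmf_of_set (grassmannian_perms n)) (pmf_of_set (grassmannian_perms n))"

end

theory Submission
  imports Defs "HOL-Real_Asymp.Real_Asymp"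
begin

text \<open>The coefficient of \<open>\<SS>\<^sub>w\<close> in a polynomial \<open>f\<close> is the constant term of \<open>\<partial>\<^sub>w f\<close>, and these
  functionals separate polynomials. Consequently \<open>f\<close> is a combination of the \<open>\<SS>\<^sub>w\<close> with
  \<open>w \<in> S\<^sub>m\<close> if and only if \<open>x\<^sub>i\<close> occurs in \<open>f\<close> with exponents at most \<open>m - i\<close> only, so
  \<open>FS u v\<close> can be read off the degrees of \<open>\<SS>\<^sub>u\<close> and \<open>\<SS>\<^sub>v\<close> in the single variables. If the only
  descent of \<open>w\<close> is \<open>m\<close>, then \<open>\<SS>\<^sub>w\<close> is symmetric in \<open>x\<^sub>1, \<dots>, x\<^sub>m\<close>, has degree \<open>w m - m\<close> in each of
  them, and contains no other variable. For \<open>u, v\<close> with descents \<open>p \<le> q\<close> this gives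
  \<open>FS u v = max (u p) q + v q - q\<close>.

  A Grassmannian permutation is determined by the set of its values before the descent. Up to an
  exponentially small error, \<open>u\<close> and \<open>v\<close> thus become independent uniform subsets \<open>A, B\<close> of
  \<open>{1..n}\<close>, and \<open>FS u v\<close> becomes \<open>max A + max B - max |A| |B|\<close>. The expectation follows from
  \<open>\<Sum>\<^sub>A \<Sum>\<^sub>B ||A| - |B|| = n (2n choose n)\<close> and Wallis' product, the limit law from the central limit
  theorem for \<open>|A|\<close>.\<close>

subsection \<open>Divided differences\<close>

text \<open>Both \<open>schubert\<close> and \<open>schubert_coeff\<close> are definite
  descriptions, so before any coefficient can be discussed, the recursions from all
  \<open>longest_perm n\<close> must be shown to agree. The functionals \<open>dual_coeff\<close>
  settle this in one stroke: every \<open>f\<close> with \<open>is_schubert w f\<close> has value 1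
  at \<open>w\<close> and 0 at all other permutations, whichever n the recursion started from, and
  values under the functionals determine a polynomial. Only the functionals involve a choice of
  reduced word, and this is where the braid relations for divided differences enter.

  On the probabilistic side, a limit law cannot give the expectation up to o(1), since the
  fluctuations are of order sqrt n. The expectation is therefore summed exactly over all pairs of
  subsets, and only the central binomial coefficient that remains is estimated, by bounds from both
  sides. The simplified formula for \<open>FS\<close> fails only if one set has more elements than
  the maximum of the other, or both are empty; the total error of order 3^n is negligible among 4^n
  pairs.\<close>

lemma lookup_map_key_inj:
  "inj f \<Longrightarrow> Poly_Mapping.lookup (Poly_Mapping.map_key f p) k = Poly_Mapping.lookup p (f k)"
  by (simp add: Poly_Mapping.map_key.rep_eq)

text \<open>As an additive group \<open>ipoly\<close> is free abelian on the exponent vectors,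
  \<open>frag_of a\<close> being the monomial with exponent \<open>a\<close>. Additive identities
  therefore need checking on monomials only.\<close>

lemma ipoly_induct [case_names zero frag_of diff]:
  assumes "P 0" "\<And>a. P (frag_of a)" "\<And>f g. P f \<Longrightarrow> P g \<Longrightarrow> P (f - g)"
  shows "P (f :: ipoly)"
  using frag_induction[of f UNIV P] assms by auto

section \<open>Exchanging two adjacent variables\<close>

definition swap_exp :: "nat \<Rightarrow> (nat \<Rightarrow>\<^sub>0 nat) \<Rightarrow> (nat \<Rightarrow>\<^sub>0 nat)" where
  "swap_exp i = Poly_Mapping.map_key (Transposition.transpose i (Suc i))"

lemma lookup_swap_exp:
  "Poly_Mapping.lookup (swap_exp i a) k = Poly_Mapping.lookup a (Transposition.transpose i (Suc i) k)"
  by (simp add: swap_exp_def lookup_map_key_inj)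

lemma swap_exp_swap_exp [simp]: "swap_exp i (swap_exp i a) = a"
  by (intro poly_mapping_eqI) (simp add: lookup_swap_exp)

lemma inj_swap_exp: "inj (swap_exp i)"
  by (metis injI swap_exp_swap_exp)

lemma swap_exp_add: "swap_exp i (a + b) = swap_exp i a + swap_exp i b"
  by (intro poly_mapping_eqI) (simp add: lookup_swap_exp lookup_add)

lemma swap_exp_single:
  "swap_exp i (Poly_Mapping.single k c) = Poly_Mapping.single (Transposition.transpose i (Suc i) k) c"
  by (intro poly_mapping_eqI) (auto simp: lookup_swap_exp lookup_single when_def transpose_eq_iff)

lemma swap_vars_eq: "swap_vars i f = Poly_Mapping.map_key (swap_exp i) f"
  by (simp add: swap_vars_def swap_exp_def)

lemma lookup_swap_vars:
  "Poly_Mapping.lookup (swap_vars i f) a = Poly_Mapping.lookup f (swap_exp i a)"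
  by (simp add: swap_vars_eq lookup_map_key_inj inj_swap_exp)

lemma swap_vars_frag_of [simp]: "swap_vars i (frag_of a) = frag_of (swap_exp i a)"
proof -
  have "frag_of a = frag_of (swap_exp i (swap_exp i a))" by simp
  then show ?thesis
    unfolding swap_vars_eq by (metis map_key_single inj_swap_exp)
qed

lemma swap_vars_diff: "swap_vars i (f - g) = swap_vars i f - swap_vars i g"
  by (intro poly_mapping_eqI) (simp add: lookup_swap_vars lookup_minus)

lemma swap_vars_0 [simp]: "swap_vars i 0 = 0"
  by (intro poly_mapping_eqI) (simp add: lookup_swap_vars)

lemma swap_vars_swap_vars [simp]: "swap_vars i (swap_vars i f) = f"
  by (intro poly_mapping_eqI) (simp add: lookup_swap_vars)

lemma frag_of_mult: "frag_of a * frag_of b = frag_of (a + b :: nat \<Rightarrow>\<^sub>0 nat)"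
  by (simp add: mult_single)

lemma var_power: "var i ^ n = frag_of (Poly_Mapping.single i n)"
proof (induction n)
  case 0
  then show ?case by simp
next
  case (Suc n)
  then show ?case by (simp add: var_def frag_of_mult single_add[symmetric])
qed

lemma swap_vars_mult: "swap_vars i (f * g) = swap_vars i f * swap_vars i g"
proof -
  have 1: "swap_vars i (frag_of a * g) = frag_of (swap_exp i a) * swap_vars i g" for a
    by (induction g rule: ipoly_induct)
       (simp_all add: frag_of_mult swap_exp_add algebra_simps swap_vars_diff)
  show ?thesis
    by (induction f rule: ipoly_induct)
       (simp_all add: 1 left_diff_distrib swap_vars_diff)
qed

lemma swap_vars_var: "swap_vars i (var k) = var (Transposition.transpose i (Suc i) k)"
  by (simp add: var_def swap_exp_single)

lemma swap_vars_commute: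
  assumes "Suc i < j"
  shows "swap_vars i (swap_vars j f) = swap_vars j (swap_vars i f)"
proof (intro poly_mapping_eqI)
  fix a
  have "swap_exp j (swap_exp i a) = swap_exp i (swap_exp j a)"
    using assms by (intro poly_mapping_eqI) (auto simp: lookup_swap_exp Transposition.transpose_def)
  then show "Poly_Mapping.lookup (swap_vars i (swap_vars j f)) a =
      Poly_Mapping.lookup (swap_vars j (swap_vars i f)) a"
    by (simp add: lookup_swap_vars)
qed

lemma swap_vars_braid:
  "swap_vars i (swap_vars (Suc i) (swap_vars i f)) =
   swap_vars (Suc i) (swap_vars i (swap_vars (Suc i) f))"
proof (intro poly_mapping_eqI)
  fix a
  have "swap_exp i (swap_exp (Suc i) (swap_exp i a)) = swap_exp (Suc i) (swap_exp i (swap_exp (Suc i) a))"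
    by (intro poly_mapping_eqI) (auto simp: lookup_swap_exp Transposition.transpose_def)
  then show "Poly_Mapping.lookup (swap_vars i (swap_vars (Suc i) (swap_vars i f))) a =
      Poly_Mapping.lookup (swap_vars (Suc i) (swap_vars i (swap_vars (Suc i) f))) a"
    by (simp add: lookup_swap_vars)
qed

text \<open>As the polynomial ring has no zero divisors, these differences can be cancelled; this
  makes the quotient in \<open>divided_difference\<close> unique.\<close>

lemma var_diff_nonzero: "i \<noteq> j \<Longrightarrow> var i - var j \<noteq> 0"
proof
  assume "i \<noteq> j" "var i - var j = 0"
  then have "frag_of (Poly_Mapping.single i (1::nat)) = frag_of (Poly_Mapping.single j 1)"
    by (simp add: var_def)
  then have "Poly_Mapping.single i (1::nat) = Poly_Mapping.single j 1"
    by (simp add: frag_of_eq)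
  then have "Poly_Mapping.lookup (Poly_Mapping.single i (1::nat)) i = Poly_Mapping.lookup (Poly_Mapping.single j 1) i"
    by simp
  with \<open>i \<noteq> j\<close> show False by (simp add: lookup_single)
qed

section \<open>Closed form of the divided difference of a monomial\<close>

definition exp_part :: "nat \<Rightarrow> (nat \<Rightarrow>\<^sub>0 nat) \<Rightarrow> nat \<Rightarrow> nat \<Rightarrow> (nat \<Rightarrow>\<^sub>0 nat)" where
  "exp_part i a c d =
     a - Poly_Mapping.single i (Poly_Mapping.lookup a i)
       - Poly_Mapping.single (Suc i) (Poly_Mapping.lookup a (Suc i))
       + Poly_Mapping.single i c + Poly_Mapping.single (Suc i) d"

lemma lookup_exp_part:
  "Poly_Mapping.lookup (exp_part i a c d) k =
     (if k = i then c else if k = Suc i then d else Poly_Mapping.lookup a k)"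
  by (auto simp: exp_part_def lookup_add lookup_minus lookup_single when_def)

lemma frag_of_exp_part:
  "frag_of (exp_part i a c d) = frag_of (exp_part i a 0 0) * var i ^ c * var (Suc i) ^ d"
  by (simp add: var_power frag_of_mult exp_part_def add.assoc)

text \<open>This is \<partial>_i of a monomial: x^p y^q - x^q y^p equals x - y times a geometric
  sum, and the second branch is the first with p and q exchanged, hence the sign. The terms are
  explicit because all degree bounds are read off from them.\<close>

definition dd_mono :: "nat \<Rightarrow> (nat \<Rightarrow>\<^sub>0 nat) \<Rightarrow> ipoly" where
  "dd_mono i a = (let p = Poly_Mapping.lookup a i; q = Poly_Mapping.lookup a (Suc i) in
     if q \<le> p then (\<Sum>c<p - q. frag_of (exp_part i a (q + c) (p - 1 - c)))
     else - (\<Sum>c<q - p. frag_of (exp_part i a (p + c) (q - 1 - c))))"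

lemma geometric_difference:
  fixes x y :: "'a :: comm_ring_1"
  assumes "q \<le> p"
  shows "(x - y) * (\<Sum>c<p - q. x ^ (q + c) * y ^ (p - 1 - c)) = x ^ p * y ^ q - x ^ q * y ^ p"
proof -
  define n where "n = p - q"
  have p: "p = q + n" using assms by (simp add: n_def)
  have "(\<Sum>c<p - q. x ^ (q + c) * y ^ (p - 1 - c)) = x ^ q * y ^ q * (\<Sum>c<n. y ^ (n - Suc c) * x ^ c)"
    unfolding sum_distrib_left p
  proof (rule sum.cong)
    fix c assume "c \<in> {..<n}"
    then have "q + n - 1 - c = q + (n - Suc c)" by auto
    then show "x ^ (q + c) * y ^ (q + n - 1 - c) = x ^ q * y ^ q * (y ^ (n - Suc c) * x ^ c)"
      by (simp add: power_add algebra_simps)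
  qed simp
  then have "(x - y) * (\<Sum>c<p - q. x ^ (q + c) * y ^ (p - 1 - c)) = x ^ q * y ^ q * (x ^ n - y ^ n)"
    by (simp add: power_diff_sumr2[of x n y] mult.left_commute)
  then show ?thesis by (simp add: p power_add algebra_simps)
qed

lemma dd_mono_eq: "(var i - var (Suc i)) * dd_mono i a = frag_of a - frag_of (swap_exp i a)"
proof -
  define p where "p = Poly_Mapping.lookup a i"
  define q where "q = Poly_Mapping.lookup a (Suc i)"
  have a: "a = exp_part i a p q"
    by (intro poly_mapping_eqI) (simp add: lookup_exp_part p_def q_def)
  have s: "swap_exp i a = exp_part i a q p"
    by (intro poly_mapping_eqI) (auto simp: lookup_exp_part lookup_swap_exp p_def q_def Transposition.transpose_def)
  define e where "e = frag_of (exp_part i a 0 0)"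
  have fa: "frag_of a = e * (var i ^ p * var (Suc i) ^ q)"
    by (subst a, subst frag_of_exp_part) (simp add: e_def mult.assoc)
  have fs: "frag_of (swap_exp i a) = e * (var i ^ q * var (Suc i) ^ p)"
    by (subst s, subst frag_of_exp_part) (simp add: e_def mult.assoc)
  show ?thesis
  proof (cases "q \<le> p")
    case True
    then have "dd_mono i a = (\<Sum>c<p - q. frag_of (exp_part i a (q + c) (p - 1 - c)))"
      by (simp add: dd_mono_def p_def q_def Let_def)
    also have "\<dots> = e * (\<Sum>c<p - q. var i ^ (q + c) * var (Suc i) ^ (p - 1 - c))"
      by (subst frag_of_exp_part) (simp add: e_def mult.assoc sum_distrib_left)
    finally show ?thesis
      unfolding fa fs using geometric_difference[OF True, of "var i" "var (Suc i)"]
      by (simp add: mult.left_commute right_diff_distrib)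
  next
    case False
    then have "dd_mono i a = - (\<Sum>c<q - p. frag_of (exp_part i a (p + c) (q - 1 - c)))"
      by (simp add: dd_mono_def p_def q_def Let_def)
    also have "\<dots> = - (e * (\<Sum>c<q - p. var i ^ (p + c) * var (Suc i) ^ (q - 1 - c)))"
      by (subst frag_of_exp_part) (simp add: e_def mult.assoc sum_distrib_left)
    finally show ?thesis
      unfolding fa fs using geometric_difference[of p q "var i" "var (Suc i)"] False
      by (simp add: mult.left_commute right_diff_distrib)
  qed
qed

text \<open>The equation for c + d yields the drop in total degree, the strict bounds on c and d the
  stability of \<open>staircase\<close>.\<close>

lemma keys_dd_mono:
  assumes "b \<in> Poly_Mapping.keys (dd_mono i a)"
  shows "\<exists>c d. b = exp_part i a c d \<and> Suc (c + d) = Poly_Mapping.lookup a i + Poly_Mapping.lookup a (Suc i)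
     \<and> c < max (Poly_Mapping.lookup a i) (Poly_Mapping.lookup a (Suc i))
     \<and> d < max (Poly_Mapping.lookup a i) (Poly_Mapping.lookup a (Suc i))"
proof -
  define p where "p = Poly_Mapping.lookup a i"
  define q where "q = Poly_Mapping.lookup a (Suc i)"
  show ?thesis
  proof (cases "q \<le> p")
    case True
    then have "dd_mono i a = (\<Sum>c<p - q. frag_of (exp_part i a (q + c) (p - 1 - c)))"
      by (simp add: dd_mono_def p_def q_def Let_def)
    with assms obtain c where "c < p - q" "b = exp_part i a (q + c) (p - 1 - c)"
      using keys_sum[of "\<lambda>c. frag_of (exp_part i a (q + c) (p - 1 - c))" "{..<p - q}"]
      by (auto simp: keys_frag_of)
    then show ?thesis
      by (intro exI[of _ "q + c"] exI[of _ "p - 1 - c"]) (auto simp: p_def[symmetric] q_def[symmetric])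
  next
    case False
    then have "dd_mono i a = - (\<Sum>c<q - p. frag_of (exp_part i a (p + c) (q - 1 - c)))"
      by (simp add: dd_mono_def p_def q_def Let_def)
    with assms obtain c where "c < q - p" "b = exp_part i a (p + c) (q - 1 - c)"
      using keys_sum[of "\<lambda>c. frag_of (exp_part i a (p + c) (q - 1 - c))" "{..<q - p}"]
      by (auto simp: keys_frag_of)
    then show ?thesis
      by (intro exI[of _ "p + c"] exI[of _ "q - 1 - c"]) (auto simp: p_def[symmetric] q_def[symmetric])
  qed
qed

lemma frag_extend_dd_mono:
  "(var i - var (Suc i)) * frag_extend (dd_mono i) f = f - swap_vars i f"
proof (induction f rule: ipoly_induct)
  case (diff a b)
  then show ?case
    by (simp add: frag_extend_diff swap_vars_diff right_diff_distrib)
qed (simp_all add: dd_mono_eq)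

lemma divided_difference_eqI:
  assumes "(var i - var (Suc i)) * g = f - swap_vars i f"
  shows "divided_difference i f = g"
  unfolding divided_difference_def
proof (rule the_equality)
  fix g' assume "(var i - var (Suc i)) * g' = f - swap_vars i f"
  with assms have "(var i - var (Suc i)) * (g' - g) = 0"
    by (simp add: right_diff_distrib)
  then show "g' = g"
    using var_diff_nonzero[of i "Suc i"] by (simp del: right_diff_distrib)
qed (fact assms)

lemma divided_difference_eq_frag_extend: "divided_difference i f = frag_extend (dd_mono i) f"
  by (rule divided_difference_eqI) (rule frag_extend_dd_mono)

lemma divided_difference_mult:
  "(var i - var (Suc i)) * divided_difference i f = f - swap_vars i f"
  by (simp add: divided_difference_eq_frag_extend frag_extend_dd_mono)

lemma divided_difference_0 [simp]: "divided_difference i 0 = 0"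
  by (simp add: divided_difference_eq_frag_extend)

lemma divided_difference_diff:
  "divided_difference i (f - g) = divided_difference i f - divided_difference i g"
  by (simp add: divided_difference_eq_frag_extend frag_extend_diff)

lemma divided_difference_eq_0_iff: "divided_difference i f = 0 \<longleftrightarrow> swap_vars i f = f"
proof
  assume "divided_difference i f = 0"
  then show "swap_vars i f = f"
    using divided_difference_mult[of i f] by simp
next
  assume "swap_vars i f = f"
  then show "divided_difference i f = 0"
    by (intro divided_difference_eqI) simp
qed

lemma swap_vars_divided_difference [simp]:
  "swap_vars i (divided_difference i f) = divided_difference i f"
proof -
  have "swap_vars i ((var i - var (Suc i)) * divided_difference i f) = swap_vars i (f - swap_vars i f)"
    by (simp only: divided_difference_mult)
  then have "(var (Suc i) - var i) * swap_vars i (divided_difference i f) = swap_vars i f - f"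
    by (simp add: swap_vars_mult swap_vars_diff swap_vars_var)
  then have "(var i - var (Suc i)) * swap_vars i (divided_difference i f) = f - swap_vars i f"
    by (simp add: algebra_simps)
  then show ?thesis by (intro divided_difference_eqI[symmetric])
qed

lemma divided_difference_idem [simp]: "divided_difference i (divided_difference i f) = 0"
  by (simp add: divided_difference_eq_0_iff)

lemma divided_difference_mult_symmetric:
  assumes "swap_vars i g = g"
  shows "divided_difference i (f * g) = divided_difference i f * g"
proof (rule divided_difference_eqI)
  have "(var i - var (Suc i)) * (divided_difference i f * g) = (f - swap_vars i f) * g"
    by (simp only: mult.assoc[symmetric] divided_difference_mult)
  then show "(var i - var (Suc i)) * (divided_difference i f * g) = f * g - swap_vars i (f * g)"
    by (simp add: swap_vars_mult assms algebra_simps)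
qed

lemma swap_vars_divided_difference_commute:
  assumes "Suc i < j \<or> Suc j < i"
  shows "swap_vars i (divided_difference j f) = divided_difference j (swap_vars i f)"
proof (rule divided_difference_eqI[symmetric])
  have "swap_vars i ((var j - var (Suc j)) * divided_difference j f) = swap_vars i (f - swap_vars j f)"
    by (simp only: divided_difference_mult)
  moreover have "swap_vars i (var j - var (Suc j)) = var j - var (Suc j)"
    using assms by (auto simp: swap_vars_diff swap_vars_var)
  moreover have "swap_vars i (swap_vars j f) = swap_vars j (swap_vars i f)"
    using assms swap_vars_commute[of i j f] swap_vars_commute[of j i f] by auto
  ultimately show "(var j - var (Suc j)) * swap_vars i (divided_difference j f) =
      swap_vars i f - swap_vars j (swap_vars i f)"
    by (simp add: swap_vars_mult swap_vars_diff)
qed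

lemma divided_difference_commute:
  assumes "Suc i < j \<or> Suc j < i"
  shows "divided_difference i (divided_difference j f) = divided_difference j (divided_difference i f)"
proof (rule divided_difference_eqI)
  have *: "swap_vars j (var i - var (Suc i)) = var i - var (Suc i)"
    using assms by (auto simp: swap_vars_diff swap_vars_var)
  \<comment> \<open>The factor x_i - x_{i+1} is invariant under \<open>swap_vars j\<close>, so it
    can be moved into \<partial>_j, where it meets \<partial>_i f.\<close>
  have "divided_difference j (divided_difference i f * (var i - var (Suc i))) =
      divided_difference j (divided_difference i f) * (var i - var (Suc i))"
    by (rule divided_difference_mult_symmetric) (rule *)
  then have "(var i - var (Suc i)) * divided_difference j (divided_difference i f) =
      divided_difference j (f - swap_vars i f)"
    by (simp add: mult.commute[of _ "var i - var (Suc i)"] divided_difference_mult del: left_diff_distrib right_diff_distrib)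
  also have "\<dots> = divided_difference j f - swap_vars i (divided_difference j f)"
    using assms by (simp add: divided_difference_diff swap_vars_divided_difference_commute)
  finally show "(var i - var (Suc i)) * divided_difference j (divided_difference i f) =
      divided_difference j f - swap_vars i (divided_difference j f)" .
qed

text \<open>After multiplication by the Vandermonde product both sides become the alternating sum of
  \<open>f\<close> over the symmetric group on three letters.\<close>

lemma divided_difference_braid:
  "divided_difference i (divided_difference (Suc i) (divided_difference i f)) =
   divided_difference (Suc i) (divided_difference i (divided_difference (Suc i) f))"
proof -
  define x y z where "x = var i" and "y = var (Suc i)" and "z = var (Suc (Suc i))"
  let ?s = "swap_vars i" and ?t = "swap_vars (Suc i)"
  let ?D = "divided_difference i" and ?E = "divided_difference (Suc i)"
  have xyz: "?s x = y" "?s y = x" "?s z = z" "?t x = x" "?t y = z" "?t z = y"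
    by (simp_all add: x_def y_def z_def swap_vars_var)
  have D: "(x - y) * ?D g = g - ?s g" for g
    by (simp add: x_def y_def divided_difference_mult)
  have E: "(y - z) * ?E g = g - ?t g" for g
    by (simp add: z_def y_def divided_difference_mult)
  note sw = swap_vars_mult swap_vars_diff xyz
  define h where "h = ?D f"
  define k where "k = ?E f"
  have h: "(x - y) * h = f - ?s f" "(x - z) * ?t h = ?t f - ?t (?s f)"
    "(y - z) * ?s (?t h) = ?s (?t f) - ?s (?t (?s f))"
  proof -
    show "(x - y) * h = f - ?s f" by (simp add: h_def D)
    then have "?t ((x - y) * h) = ?t (f - ?s f)" by simp
    then show 1: "(x - z) * ?t h = ?t f - ?t (?s f)" by (simp only: sw)
    then have "?s ((x - z) * ?t h) = ?s (?t f - ?t (?s f))" by simp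
    then show "(y - z) * ?s (?t h) = ?s (?t f) - ?s (?t (?s f))" by (simp only: sw)
  qed
  have k: "(y - z) * k = f - ?t f" "(x - z) * ?s k = ?s f - ?s (?t f)"
    "(x - y) * ?t (?s k) = ?t (?s f) - ?t (?s (?t f))"
  proof -
    show "(y - z) * k = f - ?t f" by (simp add: k_def E)
    then have "?s ((y - z) * k) = ?s (f - ?t f)" by simp
    then show 1: "(x - z) * ?s k = ?s f - ?s (?t f)" by (simp only: sw)
    then have "?t ((x - z) * ?s k) = ?t (?s f - ?s (?t f))" by simp
    then show "(x - y) * ?t (?s k) = ?t (?s f) - ?t (?s (?t f))" by (simp only: sw)
  qed
  have Eh: "(y - z) * ?E h = h - ?t h" "(x - z) * ?s (?E h) = h - ?s (?t h)"
  proof -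
    show "(y - z) * ?E h = h - ?t h" by (rule E)
    then have "?s ((y - z) * ?E h) = ?s (h - ?t h)" by simp
    then show "(x - z) * ?s (?E h) = h - ?s (?t h)" by (simp only: sw) (simp add: h_def)
  qed
  have Dk: "(x - y) * ?D k = k - ?s k" "(x - z) * ?t (?D k) = k - ?t (?s k)"
  proof -
    show "(x - y) * ?D k = k - ?s k" by (rule D)
    then have "?t ((x - y) * ?D k) = ?t (k - ?s k)" by simp
    then show "(x - z) * ?t (?D k) = k - ?t (?s k)" by (simp only: sw) (simp add: k_def)
  qed
  have "(x - y) * (x - z) * (y - z) * ?D (?E h) = (x - z) * (y - z) * (?E h - ?s (?E h))"
    by (simp only: D[of "?E h", symmetric] mult_ac)
  also have "\<dots> = (x - z) * ((y - z) * ?E h) - (y - z) * ((x - z) * ?s (?E h))"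
    by (simp add: algebra_simps)
  also have "\<dots> = (x - z) * (h - ?t h) - (y - z) * (h - ?s (?t h))"
    by (simp only: Eh)
  also have "\<dots> = (x - y) * h - (x - z) * ?t h + (y - z) * ?s (?t h)"
    by (simp add: algebra_simps)
  also have "\<dots> = f - ?s f - ?t f + ?t (?s f) + ?s (?t f) - ?s (?t (?s f))"
    by (simp only: h) simp
  also have "\<dots> = f - ?t f - ?s f + ?s (?t f) + ?t (?s f) - ?t (?s (?t f))"
    by (simp add: swap_vars_braid)
  also have "\<dots> = (y - z) * k - (x - z) * ?s k + (x - y) * ?t (?s k)"
    by (simp only: k) simp
  also have "\<dots> = (x - z) * (k - ?s k) - (x - y) * (k - ?t (?s k))"
    by (simp add: algebra_simps)
  also have "\<dots> = (x - z) * ((x - y) * ?D k) - (x - y) * ((x - z) * ?t (?D k))"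
    by (simp only: Dk)
  also have "\<dots> = (x - y) * (x - z) * (?D k - ?t (?D k))"
    by (simp add: algebra_simps)
  also have "\<dots> = (x - y) * (x - z) * (y - z) * ?E (?D k)"
    by (simp only: E[of "?D k", symmetric] mult_ac)
  finally have "(x - y) * (x - z) * (y - z) * ?D (?E h) = (x - y) * (x - z) * (y - z) * ?E (?D k)" .
  moreover have "(x - y) * (x - z) * (y - z) \<noteq> 0"
    using var_diff_nonzero[of i "Suc i"] var_diff_nonzero[of i "Suc (Suc i)"]
      var_diff_nonzero[of "Suc i" "Suc (Suc i)"]
    unfolding x_def y_def z_def by (intro no_zero_divisors) simp_all
  ultimately have "?D (?E h) = ?E (?D k)"
    by (rule iffD1[OF mult_left_cancel, rotated])
  then show ?thesis
    by (simp only: h_def k_def)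
qed

lemma keys_divided_difference:
  assumes "b \<in> Poly_Mapping.keys (divided_difference i f)"
  obtains a c d where "a \<in> Poly_Mapping.keys f" "b = exp_part i a c d"
    "Suc (c + d) = Poly_Mapping.lookup a i + Poly_Mapping.lookup a (Suc i)"
    "c < max (Poly_Mapping.lookup a i) (Poly_Mapping.lookup a (Suc i))"
    "d < max (Poly_Mapping.lookup a i) (Poly_Mapping.lookup a (Suc i))"
proof -
  from assms obtain a where "a \<in> Poly_Mapping.keys f" "b \<in> Poly_Mapping.keys (dd_mono i a)"
    unfolding divided_difference_eq_frag_extend using keys_frag_extend[of "dd_mono i" f] by blast
  with keys_dd_mono[OF this(2)] that show ?thesis by blast
qed

subsection \<open>Permutations and inversions\<close>

abbreviation adj :: "nat \<Rightarrow> nat \<Rightarrow> nat" where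
  "adj i \<equiv> Transposition.transpose i (Suc i)"

definition inversions :: "(nat \<Rightarrow> nat) \<Rightarrow> (nat \<times> nat) set" where
  "inversions w = {(a, b). a < b \<and> w b < w a}"

definition len :: "(nat \<Rightarrow> nat) \<Rightarrow> nat" where
  "len w = card (inversions w)"

lemma permutes_1_0: "w permutes {1..n::nat} \<Longrightarrow> w 0 = 0"
  by (rule permutes_not_in) auto

lemma S_inf_0: "w \<in> S_inf \<Longrightarrow> w 0 = 0"
  unfolding S_inf_def using permutes_1_0 by blast

lemma permutes_in_S_inf: "w permutes {1..n} \<Longrightarrow> w \<in> S_inf"
  by (auto simp: S_inf_def)

lemma S_inf_inj: "w \<in> S_inf \<Longrightarrow> inj w"
  by (auto simp: S_inf_def permutes_inj)

lemma id_in_S_inf [simp]: "id \<in> S_inf"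
  by (auto simp: S_inf_def intro: permutes_id exI[of _ 0])

lemma permutes_atLeast1_mono: "w permutes {1..m} \<Longrightarrow> m \<le> n \<Longrightarrow> w permutes {1..n::nat}"
  by (rule permutes_subset) auto

lemma adj_permutes: "1 \<le> i \<Longrightarrow> i < n \<Longrightarrow> adj i permutes {1..n}"
  by (rule permutes_swap_id) auto

definition swap_pos :: "(nat \<Rightarrow> nat) \<Rightarrow> nat \<Rightarrow> nat \<Rightarrow> nat" where
  "swap_pos w i = w \<circ> adj i"

lemma swap_pos_apply [simp]: "swap_pos w i k = w (adj i k)"
  by (simp add: swap_pos_def)

lemma permutes_swap_pos: "w permutes {1..n} \<Longrightarrow> 1 \<le> i \<Longrightarrow> i < n \<Longrightarrow> swap_pos w i permutes {1..n}"
  unfolding swap_pos_def by (intro permutes_compose adj_permutes)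

lemma swap_pos_swap_pos [simp]: "swap_pos (swap_pos w i) i = w"
  by (simp add: fun_eq_iff)

lemma S_inf_swap_pos:
  assumes "w \<in> S_inf" "1 \<le> i"
  shows "swap_pos w i \<in> S_inf"
proof -
  from assms obtain n where "w permutes {1..n}" by (auto simp: S_inf_def)
  then have "w permutes {1..max n (Suc i)}"
    by (rule permutes_atLeast1_mono) auto
  then have "swap_pos w i permutes {1..max n (Suc i)}"
    using assms by (intro permutes_swap_pos) auto
  then show ?thesis by (rule permutes_in_S_inf)
qed

lemma descent_pos: "w \<in> S_inf \<Longrightarrow> w (Suc i) < w i \<Longrightarrow> 1 \<le> i"
  using S_inf_0[of w] by (cases i) auto

text \<open>A position beyond n is fixed and carries a larger value than all positions before it;
  position 0 carries the least value.\<close>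

lemma inversions_subset:
  assumes "w permutes {1..n}"
  shows "inversions w \<subseteq> {(a, b). 1 \<le> a \<and> a < b \<and> b \<le> n}"
proof clarify
  fix a b assume "(a, b) \<in> inversions w"
  then have ab: "a < b" "w b < w a" by (auto simp: inversions_def)
  have "a \<noteq> 0" using ab permutes_1_0[OF assms] by (intro notI) simp
  moreover have "b \<le> n"
  proof (rule ccontr)
    assume "\<not> b \<le> n"
    then have b: "w b = b" using assms by (intro permutes_not_in) auto
    show False
    proof (cases "a \<in> {1..n}")
      case True
      then have "w a \<in> {1..n}" by (simp only: permutes_in_image[OF assms])
      then show False using ab b \<open>\<not> b \<le> n\<close> by simp
    next
      case False
      then have "w a = a" using assms by (intro permutes_not_in) auto
      then show False using ab b by simp
    qed
  qed
  ultimately show "1 \<le> a \<and> a < b \<and> b \<le> n" using ab by simp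
qed

lemma finite_pairs: "finite {(a, b). 1 \<le> a \<and> a < b \<and> b \<le> (n::nat)}"
  by (rule finite_subset[of _ "{..n} \<times> {..n}"]) auto

lemma len_id [simp]: "len id = 0"
proof -
  have "inversions id = {}" by (auto simp: inversions_def)
  then show ?thesis by (simp add: len_def)
qed

lemma finite_inversions: "w \<in> S_inf \<Longrightarrow> finite (inversions w)"
  unfolding S_inf_def using inversions_subset finite_pairs finite_subset by blast

text \<open>The transposition reverses the order of the pair \<open>(i, Suc i)\<close> only. Applied
  to both positions it matches the inversions of the two permutations, apart from that pair.\<close>

lemma len_swap_pos:
  assumes "w \<in> S_inf" "w (Suc i) < w i"
  shows "len w = Suc (len (swap_pos w i))"
proof -
  let ?s = "adj i"
  have less: "?s a < ?s b" if "a < b" "(a, b) \<noteq> (i, Suc i)" for a b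
    using that by (auto simp: Transposition.transpose_def)
  have "bij_betw (map_prod ?s ?s) (inversions (swap_pos w i)) (inversions w - {(i, Suc i)})"
  proof (rule bij_betwI[where g = "map_prod ?s ?s"])
    show "map_prod ?s ?s \<in> inversions (swap_pos w i) \<rightarrow> inversions w - {(i, Suc i)}"
    proof clarify
      fix a b assume ab: "(a, b) \<in> inversions (swap_pos w i)"
      then have "(a, b) \<noteq> (i, Suc i)" using assms by (auto simp: inversions_def)
      with ab have "?s a < ?s b" by (intro less) (auto simp: inversions_def)
      moreover have "(?s a, ?s b) \<noteq> (i, Suc i)"
        using ab by (auto simp: inversions_def transpose_eq_iff)
      ultimately show "map_prod ?s ?s (a, b) \<in> inversions w - {(i, Suc i)}"
        using ab by (auto simp: inversions_def)
    qed
    show "map_prod ?s ?s \<in> inversions w - {(i, Suc i)} \<rightarrow> inversions (swap_pos w i)"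
      using less by (auto simp: inversions_def)
  qed auto
  then have "card (inversions (swap_pos w i)) = card (inversions w - {(i, Suc i)})"
    by (rule bij_betw_same_card)
  moreover have "(i, Suc i) \<in> inversions w" using assms by (simp add: inversions_def)
  then have "card (inversions w) = Suc (card (inversions w - {(i, Suc i)}))"
    by (rule card.remove[OF finite_inversions[OF assms(1)]])
  ultimately show ?thesis
    unfolding len_def by (simp only:)
qed

text \<open>A strictly increasing map on the naturals lies above the identity, and here this applies
  to \<open>w\<close> and to its inverse.\<close>

lemma strict_mono_permutes_imp_id:
  assumes "w permutes {1..n::nat}" "strict_mono w"
  shows "w = id"
proof -
  have "strict_mono (inv w)"
    using assms by (intro strict_monoI)
      (metis linorder_neq_iff not_less_iff_gr_or_eq permutes_inverses(1) strict_mono_less)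
  then have "k \<le> inv w k" for k by (rule strict_mono_imp_increasing)
  then have "w k \<le> k" for k using assms by (metis permutes_inverses(2))
  moreover have "k \<le> w k" for k using assms(2) by (rule strict_mono_imp_increasing)
  ultimately show ?thesis by (simp add: fun_eq_iff antisym)
qed

lemma no_descent_imp_id:
  assumes "w \<in> S_inf" "\<And>i. \<not> w (Suc i) < w i"
  shows "w = id"
proof -
  have "strict_mono w"
    unfolding strict_mono_Suc_iff using assms S_inf_inj[OF assms(1)]
    by (metis inj_eq linorder_neqE_nat n_not_Suc_n)
  then show ?thesis
    using assms strict_mono_permutes_imp_id by (auto simp: S_inf_def)
qed

lemma exists_descent:
  assumes "w \<in> S_inf" "w \<noteq> id"
  obtains i where "1 \<le> i" "w (Suc i) < w i"
  using no_descent_imp_id[OF assms(1)] assms(2) descent_pos[OF assms(1)] by blast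

lemma longest_perm_permutes: "longest_perm n permutes {1..n}"
proof (rule bij_imp_permutes)
  show "bij_betw (longest_perm n) {1..n} {1..n}"
    by (rule bij_betwI[where g = "longest_perm n"]) (auto simp: longest_perm_def)
qed (auto simp: longest_perm_def)

lemma longest_perm_longest_perm: "longest_perm n (longest_perm n k) = k"
  by (auto simp: longest_perm_def)

lemma exists_ascent:
  assumes "w permutes {1..n}" "w \<noteq> longest_perm n"
  obtains i where "1 \<le> i" "i < n" "w i < w (Suc i)"
proof -
  have "\<exists>i. 1 \<le> i \<and> i < n \<and> w i < w (Suc i)"
  proof (rule ccontr)
    assume *: "\<nexists>i. 1 \<le> i \<and> i < n \<and> w i < w (Suc i)"
    \<comment> \<open>Reversing the values turns the absence of ascents into the absence of
      descents. The positions inside the range, at or beyond its upper end, and 0 are checked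
      separately.\<close>
    let ?u = "longest_perm n \<circ> w"
    have u: "?u permutes {1..n}"
      using assms longest_perm_permutes by (intro permutes_compose)
    have "?u (Suc i) \<ge> ?u i" for i
    proof (cases "1 \<le> i \<and> i < n")
      case True
      then have "w i \<in> {1..n}" "w (Suc i) \<in> {1..n}" "w (Suc i) \<le> w i"
        using * by (simp_all only: permutes_in_image[OF assms(1)]) (auto simp: not_less)
      then show ?thesis by (auto simp: longest_perm_def)
    next
      case False
      show ?thesis
      proof (cases "i = 0")
        case False
        with \<open>\<not> (1 \<le> i \<and> i < n)\<close> have "?u (Suc i) = Suc i"
          using permutes_not_in[OF u, of "Suc i"] by auto
        moreover have "?u i \<le> i"
        proof (cases "i \<in> {1..n}")
          case True
          then have "?u i \<in> {1..n}" by (simp only: permutes_in_image[OF u])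
          then show ?thesis using True \<open>\<not> (1 \<le> i \<and> i < n)\<close> by auto
        qed (use permutes_not_in[OF u, of i] in auto)
        ultimately show ?thesis by simp
      qed (use permutes_1_0[OF u] in auto)
    qed
    then have "?u = id"
      by (intro no_descent_imp_id permutes_in_S_inf[OF u]) (simp add: not_less)
    then have "longest_perm n (w k) = k" for k by (simp add: fun_eq_iff)
    then have "w k = longest_perm n k" for k by (metis longest_perm_longest_perm)
    with assms(2) show False by auto
  qed
  with that show ?thesis by blast
qed

lemma inversions_longest_perm: "inversions (longest_perm n) = {(a, b). 1 \<le> a \<and> a < b \<and> b \<le> n}"
  using inversions_subset[OF longest_perm_permutes, of n]
  by (auto simp: inversions_def longest_perm_def)

lemma len_le_longest_perm: "w permutes {1..n} \<Longrightarrow> len w \<le> len (longest_perm n)"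
  unfolding len_def inversions_longest_perm
  by (intro card_mono finite_pairs inversions_subset)

lemma len_swap_pos_ascent:
  assumes "w \<in> S_inf" "1 \<le> i" "w i < w (Suc i)"
  shows "len (swap_pos w i) = Suc (len w)"
  using len_swap_pos[OF S_inf_swap_pos[OF assms(1,2)], of i] assms(3) by simp

lemma len_less_longest_perm:
  assumes "w permutes {1..n}" "w \<noteq> longest_perm n"
  shows "len w < len (longest_perm n)"
proof -
  obtain i where i: "1 \<le> i" "i < n" "w i < w (Suc i)" using exists_ascent[OF assms] .
  have "len (swap_pos w i) \<le> len (longest_perm n)"
    using assms i by (intro len_le_longest_perm permutes_swap_pos)
  moreover have "len (swap_pos w i) = Suc (len w)"
    using assms i by (intro len_swap_pos_ascent permutes_in_S_inf)
  ultimately show ?thesis by simp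
qed

subsection \<open>The functionals dual to the Schubert polynomials\<close>

text \<open>The coefficient functional of \<open>w\<close>: apply the divided differences along a reduced word of
  \<open>w\<close> and take the constant term. Peeling off the least descent fixes one such word.\<close>

primrec word_coeff :: "nat \<Rightarrow> (nat \<Rightarrow> nat) \<Rightarrow> ipoly \<Rightarrow> int" where
  "word_coeff 0 w f = Poly_Mapping.lookup f 0"
| "word_coeff (Suc l) w f = (let i = (LEAST i. w (Suc i) < w i) in
     word_coeff l (swap_pos w i) (divided_difference i f))"

definition dual_coeff :: "(nat \<Rightarrow> nat) \<Rightarrow> ipoly \<Rightarrow> int" where
  "dual_coeff w f = word_coeff (len w) w f"

lemma dual_coeff_id [simp]: "dual_coeff id f = Poly_Mapping.lookup f 0"
  by (simp add: dual_coeff_def)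

lemma dual_coeff_diff: "dual_coeff w (f - g) = dual_coeff w f - dual_coeff w g"
proof -
  have "word_coeff l w (f - g) = word_coeff l w f - word_coeff l w g" for l
    by (induction l arbitrary: w f g) (simp_all add: lookup_minus divided_difference_diff Let_def)
  then show ?thesis by (simp add: dual_coeff_def)
qed

lemma dual_coeff_0 [simp]: "dual_coeff w 0 = 0"
  using dual_coeff_diff[of w 0 0] by simp

lemma dual_coeff_add: "dual_coeff w (f + g) = dual_coeff w f + dual_coeff w g"
  using dual_coeff_diff[of w "f + g" g] by simp

lemma dual_coeff_sum: "dual_coeff w (sum f T) = (\<Sum>x\<in>T. dual_coeff w (f x))"
  by (induction T rule: infinite_finite_induct) (simp_all add: dual_coeff_add)

lemma dual_coeff_of_int: "dual_coeff w (of_int c * f) = c * dual_coeff w f"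
proof (induction c rule: int_induct[where k = 0])
  case (step1 i)
  then show ?case by (simp add: distrib_right dual_coeff_add)
next
  case (step2 i)
  then show ?case by (simp add: left_diff_distrib dual_coeff_diff)
qed simp

section \<open>Independence of the reduced word\<close>

lemma swap_pos_commute:
  assumes "Suc i < j"
  shows "swap_pos (swap_pos w i) j = swap_pos (swap_pos w j) i"
  using assms by (auto simp: fun_eq_iff Transposition.transpose_def)

lemma swap_pos_braid:
  "swap_pos (swap_pos (swap_pos w i) (Suc i)) i = swap_pos (swap_pos (swap_pos w (Suc i)) i) (Suc i)"
  by (auto simp: fun_eq_iff Transposition.transpose_def)

text \<open>Induction on the length, in the manner of Matsumoto's theorem: two descents k < l can be
  continued to a common shorter permutation, by the other swap if they are far apart and along the
  two braid words if they are adjacent. The relations between divided differences identify the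
  resulting polynomials.\<close>

lemma dual_coeff_step:
  assumes "w \<in> S_inf" "w (Suc i) < w i"
  shows "dual_coeff w f = dual_coeff (swap_pos w i) (divided_difference i f)"
  using assms
proof (induction "len w" arbitrary: w f i rule: less_induct)
  case less
  have IH: "dual_coeff v g = dual_coeff (swap_pos v k) (divided_difference k g)"
    if "len v < len w" "v \<in> S_inf" "v (Suc k) < v k" for v g k
    using less.hyps that by blast
  have S: "swap_pos w k \<in> S_inf" "len (swap_pos w k) < len w" if "w (Suc k) < w k" for k
    using that len_swap_pos[OF \<open>w \<in> S_inf\<close>] descent_pos[OF \<open>w \<in> S_inf\<close> that] \<open>w \<in> S_inf\<close>
    by (auto intro: S_inf_swap_pos)
  have S2: "swap_pos (swap_pos w k) l \<in> S_inf" "len (swap_pos (swap_pos w k) l) < len w"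
    if "w (Suc k) < w k" "swap_pos w k (Suc l) < swap_pos w k l" for k l
  proof -
    note Sk = S[OF that(1)]
    show "swap_pos (swap_pos w k) l \<in> S_inf" by (rule S_inf_swap_pos[OF Sk(1) descent_pos[OF Sk(1) that(2)]])
    show "len (swap_pos (swap_pos w k) l) < len w"
      using Sk(2) len_swap_pos[OF Sk(1) that(2)] by linarith
  qed
  have indep: "dual_coeff (swap_pos w k) (divided_difference k f) = dual_coeff (swap_pos w l) (divided_difference l f)"
    if k: "w (Suc k) < w k" and l: "w (Suc l) < w l" and "k < l" for k l
  proof (cases "l = Suc k")
    case False
    with \<open>k < l\<close> have kl: "Suc k < l" by simp
    then have d: "swap_pos w k (Suc l) < swap_pos w k l" "swap_pos w l (Suc k) < swap_pos w l k"
      using k l by (auto simp: Transposition.transpose_def)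
    show ?thesis
      using IH[where v = "swap_pos w k", OF S(2,1)[OF k] d(1), where g = "divided_difference k f"]
        IH[where v = "swap_pos w l", OF S(2,1)[OF l] d(2), where g = "divided_difference l f"]
        swap_pos_commute[OF kl, of w] divided_difference_commute[of k l f] kl
      by simp
  next
    case True
    \<comment> \<open>Here w k > w (k + 1) > w (k + 2), so each of the three swaps in either braid
      word removes a descent.\<close>
    have d1: "swap_pos w k (Suc l) < swap_pos w k l" "swap_pos w l (Suc k) < swap_pos w l k"
      using k l True by (auto simp: Transposition.transpose_def)
    have d2: "(swap_pos (swap_pos w k) l) (Suc k) < (swap_pos (swap_pos w k) l) k"
      "(swap_pos (swap_pos w l) k) (Suc l) < (swap_pos (swap_pos w l) k) l"
      using k l True by (auto simp: Transposition.transpose_def)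
    show ?thesis
      using IH[where v = "swap_pos w k", OF S(2,1)[OF k] d1(1), where g = "divided_difference k f"]
        IH[where v = "swap_pos (swap_pos w k) l", OF S2(2,1)[OF k d1(1)] d2(1), where g = "divided_difference l (divided_difference k f)"]
        IH[where v = "swap_pos w l", OF S(2,1)[OF l] d1(2), where g = "divided_difference l f"]
        IH[where v = "swap_pos (swap_pos w l) k", OF S2(2,1)[OF l d1(2)] d2(2), where g = "divided_difference k (divided_difference l f)"]
        swap_pos_braid[of w k] divided_difference_braid[of k f] True
      by simp
  qed
  define j where "j = (LEAST i. w (Suc i) < w i)"
  have j: "w (Suc j) < w j" unfolding j_def using less.prems(2) by (rule LeastI)
  have "dual_coeff w f = dual_coeff (swap_pos w j) (divided_difference j f)"
    unfolding dual_coeff_def len_swap_pos[OF less.prems(1) j] by (simp add: j_def[symmetric])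
  then show ?case
    using indep[OF j less.prems(2)] indep[OF less.prems(2) j] by (metis linorder_neqE_nat)
qed

text \<open>At an ascent this is \<open>dual_coeff_step\<close> for \<open>swap_pos v i\<close>,
  read backwards. At a descent a second \<partial>_i splits off, and \<partial>_i squares to
  zero.\<close>

lemma dual_coeff_divided_difference:
  assumes "v \<in> S_inf" "1 \<le> i"
  shows "dual_coeff v (divided_difference i f) =
    (if v i < v (Suc i) then dual_coeff (swap_pos v i) f else 0)"
proof (cases "v i < v (Suc i)")
  case True
  then show ?thesis
    using dual_coeff_step[OF S_inf_swap_pos[OF assms], of i f] by simp
next
  case False
  then have "v (Suc i) < v i"
    using inj_eq[OF S_inf_inj[OF assms(1)], of i "Suc i"] by auto
  with False show ?thesis
    using dual_coeff_step[OF assms(1), of i "divided_difference i f"] by simp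
qed

text \<open>Polynomials in the span of the divisors of the staircase monomial
  \<open>x\<^sub>1\<^bsup>m-1\<^esup> x\<^sub>2\<^bsup>m-2\<^esup> \<dots> x\<^sub>m\<^sub>-\<^sub>1\<close>; truncated subtraction excludes the variables \<open>x\<^sub>i\<close> with \<open>i \<ge> m\<close>.\<close>

definition staircase :: "nat \<Rightarrow> ipoly set" where
  "staircase m = {f. \<forall>a \<in> Poly_Mapping.keys f. \<forall>i. Poly_Mapping.lookup a i \<le> (if i = 0 then 0 else m - i)}"

lemma staircaseD:
  "f \<in> staircase m \<Longrightarrow> a \<in> Poly_Mapping.keys f \<Longrightarrow> Poly_Mapping.lookup a i \<le> (if i = 0 then 0 else m - i)"
  by (simp add: staircase_def)

lemma staircase_0 [simp]: "0 \<in> staircase m"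
  by (simp add: staircase_def)

lemma staircase_mono: "f \<in> staircase m \<Longrightarrow> m \<le> n \<Longrightarrow> f \<in> staircase n"
  unfolding staircase_def by (fastforce intro: order_trans diff_le_mono)

lemma staircase_add: "f \<in> staircase m \<Longrightarrow> g \<in> staircase m \<Longrightarrow> f + g \<in> staircase m"
  unfolding staircase_def using keys_add[of f g] by blast

lemma staircase_diff: "f \<in> staircase m \<Longrightarrow> g \<in> staircase m \<Longrightarrow> f - g \<in> staircase m"
  unfolding staircase_def using keys_diff[of f g] by blast

lemma staircase_sum: "(\<And>x. x \<in> T \<Longrightarrow> f x \<in> staircase m) \<Longrightarrow> sum f T \<in> staircase m"
  by (induction T rule: infinite_finite_induct) (auto intro: staircase_add)

lemma staircase_of_int: "f \<in> staircase m \<Longrightarrow> of_int c * f \<in> staircase m"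
proof (induction c rule: int_induct[where k = 0])
  case (step1 i)
  then show ?case by (simp add: distrib_right staircase_add)
next
  case (step2 i)
  then show ?case by (simp add: left_diff_distrib staircase_diff)
qed simp

text \<open>A crude bound: it only ensures that a product lies in some staircase, so that it has a
  finite expansion.\<close>

lemma staircase_mult:
  assumes "f \<in> staircase m" "g \<in> staircase n"
  shows "f * g \<in> staircase (m + n)"
  unfolding staircase_def
proof (intro CollectI ballI allI)
  fix a i assume "a \<in> Poly_Mapping.keys (f * g)"
  then obtain b c where bc: "b \<in> Poly_Mapping.keys f" "c \<in> Poly_Mapping.keys g" "a = b + c"
    using keys_mult[of f g] by blast
  then show "Poly_Mapping.lookup a i \<le> (if i = 0 then 0 else m + n - i)"
    using staircaseD[OF assms(1) bc(1), of i] staircaseD[OF assms(2) bc(2), of i]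
    by (auto simp: lookup_add split: if_splits)
qed

text \<open>Both new exponents are strictly below the larger old one, hence below m - i. This is
  exactly the bound required of x_{i+1}.\<close>

lemma staircase_divided_difference:
  assumes "f \<in> staircase m" "1 \<le> i"
  shows "divided_difference i f \<in> staircase m"
  unfolding staircase_def
proof (intro CollectI ballI allI)
  fix b k assume "b \<in> Poly_Mapping.keys (divided_difference i f)"
  then obtain a c d where a: "a \<in> Poly_Mapping.keys f" "b = exp_part i a c d"
    "c < max (Poly_Mapping.lookup a i) (Poly_Mapping.lookup a (Suc i))"
    "d < max (Poly_Mapping.lookup a i) (Poly_Mapping.lookup a (Suc i))"
    by (rule keys_divided_difference)
  then show "Poly_Mapping.lookup b k \<le> (if k = 0 then 0 else m - k)"
    using staircaseD[OF assms(1) a(1), of i] staircaseD[OF assms(1) a(1), of "Suc i"]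
      staircaseD[OF assms(1) a(1), of k] assms(2)
    by (auto simp: lookup_exp_part)
qed

lemma divided_difference_staircase_eq_0:
  assumes "f \<in> staircase m" "1 \<le> i" "m \<le> i"
  shows "divided_difference i f = 0"
proof -
  have "b \<notin> Poly_Mapping.keys (divided_difference i f)" for b
  proof
    assume "b \<in> Poly_Mapping.keys (divided_difference i f)"
    then obtain a c d where a: "a \<in> Poly_Mapping.keys f" 
      "c < max (Poly_Mapping.lookup a i) (Poly_Mapping.lookup a (Suc i))"
      by (rule keys_divided_difference)
    then show False
      using staircaseD[OF assms(1) a(1), of i] staircaseD[OF assms(1) a(1), of "Suc i"] assms by simp
  qed
  then show ?thesis using keys_eq_empty by blast
qed

text \<open>Peel off a descent i of \<open>v\<close>. For i < m the shorter permutation is still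
  outside S_m; for i >= m neither x_i nor x_{i+1} occurs in \<open>f\<close>, so \<partial>_i f =
  0.\<close>

lemma dual_coeff_eq_0_outside:
  assumes "v \<in> S_inf" "f \<in> staircase m" "\<not> v permutes {1..m}"
  shows "dual_coeff v f = 0"
  using assms
proof (induction "len v" arbitrary: v f rule: less_induct)
  case less
  have "v \<noteq> id" using less.prems(3) permutes_id by blast
  then obtain i where i: "1 \<le> i" "v (Suc i) < v i" using exists_descent less.prems(1) by blast
  show ?case
  proof (cases "i < m")
    case True
    have "\<not> swap_pos v i permutes {1..m}"
    proof
      assume "swap_pos v i permutes {1..m}"
      then have "swap_pos (swap_pos v i) i permutes {1..m}" 
        using i True by (intro permutes_swap_pos[where w = "swap_pos v i"])
      with less.prems(3) show False by simp
    qed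
    then have "dual_coeff (swap_pos v i) (divided_difference i f) = 0"
      using less.prems i len_swap_pos[of v i]
      by (intro less.hyps) (auto intro: S_inf_swap_pos staircase_divided_difference)
    then show ?thesis using dual_coeff_step[OF less.prems(1) i(2)] by simp
  next
    case False
    then show ?thesis
      using dual_coeff_step[OF less.prems(1) i(2), of f] i
        divided_difference_staircase_eq_0[OF less.prems(2), of i] by simp
  qed
qed

section \<open>Total degree and homogeneity\<close>

definition total_degree :: "(nat \<Rightarrow>\<^sub>0 nat) \<Rightarrow> nat" where
  "total_degree a = (\<Sum>k\<in>Poly_Mapping.keys a. Poly_Mapping.lookup a k)"

lemma total_degree_eq:
  assumes "finite T" "Poly_Mapping.keys a \<subseteq> T"
  shows "total_degree a = (\<Sum>k\<in>T. Poly_Mapping.lookup a k)"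
  unfolding total_degree_def using assms
  by (intro sum.mono_neutral_left) (auto simp: in_keys_iff)

lemma total_degree_divided_difference:
  assumes "b \<in> Poly_Mapping.keys (divided_difference i f)"
  obtains a where "a \<in> Poly_Mapping.keys f" "total_degree a = Suc (total_degree b)"
proof -
  from assms obtain a c d where a: "a \<in> Poly_Mapping.keys f" "b = exp_part i a c d"
    "Suc (c + d) = Poly_Mapping.lookup a i + Poly_Mapping.lookup a (Suc i)"
    by (rule keys_divided_difference)
  let ?T = "Poly_Mapping.keys a - {i, Suc i}"
  have split: "total_degree e = Poly_Mapping.lookup e i + Poly_Mapping.lookup e (Suc i) +
      (\<Sum>k\<in>?T. Poly_Mapping.lookup e k)"
    if "Poly_Mapping.keys e \<subseteq> insert i (insert (Suc i) ?T)" for e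
    using total_degree_eq[OF _ that] by simp
  have "total_degree a = Poly_Mapping.lookup a i + Poly_Mapping.lookup a (Suc i) +
      (\<Sum>k\<in>?T. Poly_Mapping.lookup a k)"
    by (rule split) auto
  moreover have "total_degree b = c + d + (\<Sum>k\<in>?T. Poly_Mapping.lookup a k)"
    by (subst split) (auto simp: a(2) in_keys_iff lookup_exp_part split: if_splits intro!: sum.cong)
  ultimately show ?thesis using that a by simp
qed

text \<open>Each divided difference lowers the degree by one, and a constant term can only remain
  after exactly d of them.\<close>

lemma dual_coeff_homogeneous:
  assumes "v \<in> S_inf" "\<And>a. a \<in> Poly_Mapping.keys f \<Longrightarrow> total_degree a = d" "dual_coeff v f \<noteq> 0"
  shows "len v = d"
  using assms
proof (induction "len v" arbitrary: v f d rule: less_induct)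
  case less
  show ?case
  proof (cases "v = id")
    case True
    then have "0 \<in> Poly_Mapping.keys f" using less.prems(3) by (simp add: in_keys_iff)
    then have "total_degree 0 = d" by (rule less.prems(2))
    then show ?thesis using True by (simp add: total_degree_def)
  next
    case False
    then obtain i where i: "1 \<le> i" "v (Suc i) < v i" using exists_descent less.prems(1) by blast
    have nz: "dual_coeff (swap_pos v i) (divided_difference i f) \<noteq> 0"
      using dual_coeff_step[OF less.prems(1) i(2)] less.prems(3) by simp
    have deg: "Suc (total_degree b) = d" if "b \<in> Poly_Mapping.keys (divided_difference i f)" for b
      using total_degree_divided_difference[OF that] less.prems(2) by metis
    have "len (swap_pos v i) = d - 1"
    proof (rule less.hyps)
      show "len (swap_pos v i) < len v" "swap_pos v i \<in> S_inf"
        using len_swap_pos[OF less.prems(1) i(2)] less.prems(1) i by (auto intro: S_inf_swap_pos)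
      show "total_degree b = d - 1" if "b \<in> Poly_Mapping.keys (divided_difference i f)" for b
        using deg[OF that] by simp
    qed (fact nz)
    \<comment> \<open>Needed because \<open>d - 1\<close> is truncated: a term of the nonzero
      \<partial>_i f comes from a term of \<open>f\<close> of positive degree.\<close>
    moreover have "d \<noteq> 0"
    proof -
      have "divided_difference i f \<noteq> 0" using nz by auto
      then obtain b where "b \<in> Poly_Mapping.keys (divided_difference i f)"
        using keys_eq_empty by blast
      from deg[OF this] show ?thesis by simp
    qed
    ultimately show ?thesis using len_swap_pos[OF less.prems(1) i(2)] by simp
  qed
qed

section \<open>Symmetric polynomials and separation by the functionals\<close>

lemma swap_exp_in_keys:
  assumes "swap_vars i f = f" "a \<in> Poly_Mapping.keys f"
  shows "swap_exp i a \<in> Poly_Mapping.keys f"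
proof -
  have "Poly_Mapping.lookup f (swap_exp i a) = Poly_Mapping.lookup f a"
    using assms(1) by (metis lookup_swap_vars)
  then show ?thesis using assms(2) by (simp add: in_keys_iff)
qed

text \<open>If x_k occurred, the swaps would carry it to variables of arbitrarily large index, but
  no variable beyond x_m occurs in \<open>staircase m\<close>.\<close>

lemma symmetric_imp_lookup_0:
  assumes "f \<in> staircase m" "\<And>i. p \<le> i \<Longrightarrow> swap_vars i f = f" "a \<in> Poly_Mapping.keys f" "1 \<le> p" "p \<le> k"
  shows "Poly_Mapping.lookup a k = 0"
proof (rule ccontr)
  assume nz: "Poly_Mapping.lookup a k \<noteq> 0"
  have "\<exists>b \<in> Poly_Mapping.keys f. Poly_Mapping.lookup b (k + j) \<noteq> 0" for j
  proof (induction j)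
    case 0
    then show ?case using assms(3) nz by auto
  next
    case (Suc j)
    then obtain b where b: "b \<in> Poly_Mapping.keys f" "Poly_Mapping.lookup b (k + j) \<noteq> 0" by blast
    have "swap_exp (k + j) b \<in> Poly_Mapping.keys f"
      using assms(2,5) b by (intro swap_exp_in_keys) auto
    moreover have "Poly_Mapping.lookup (swap_exp (k + j) b) (k + Suc j) \<noteq> 0"
      using b by (simp add: lookup_swap_exp)
    ultimately show ?case by blast
  qed
  then obtain b where "b \<in> Poly_Mapping.keys f" "Poly_Mapping.lookup b (k + m) \<noteq> 0" by blast
  then show False using staircaseD[OF assms(1), of b "k + m"] assms(4,5) by simp
qed

lemma symmetric_imp_keys_0:
  assumes "f \<in> staircase m" "\<And>i. 1 \<le> i \<Longrightarrow> swap_vars i f = f" "a \<in> Poly_Mapping.keys f"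
  shows "a = 0"
proof (rule poly_mapping_eqI)
  fix k
  show "Poly_Mapping.lookup a k = Poly_Mapping.lookup 0 k"
    using symmetric_imp_lookup_0[OF assms, of k] staircaseD[OF assms(1,3), of k] by (cases k) auto
qed

text \<open>Induction on a degree bound. All functionals vanish on each \<partial>_i f as well, so
  \<partial>_i f = 0 by induction. Hence \<open>f\<close> is symmetric in all variables and must be
  constant, and its constant term is the functional of \<open>id\<close>.\<close>

lemma dual_coeff_separates:
  assumes "f \<in> staircase m" "\<And>v. v \<in> S_inf \<Longrightarrow> dual_coeff v f = 0"
  shows "f = 0"
proof -
  have "\<forall>f. f \<in> staircase m \<longrightarrow> (\<forall>v \<in> S_inf. dual_coeff v f = 0) \<longrightarrow>
      (\<forall>a \<in> Poly_Mapping.keys f. total_degree a < D) \<longrightarrow> f = 0" for D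
  proof (induction D)
    case 0
    then show ?case by (metis keys_eq_empty less_zeroE ex_in_conv)
  next
    case (Suc D)
    show ?case
    proof (intro allI impI)
      fix f assume f: "f \<in> staircase m" "\<forall>v \<in> S_inf. dual_coeff v f = 0"
        "\<forall>a \<in> Poly_Mapping.keys f. total_degree a < Suc D"
      have "divided_difference i f = 0" if i: "1 \<le> i" for i
      proof -
        have "divided_difference i f \<in> staircase m" using f i by (intro staircase_divided_difference)
        moreover have "\<forall>v \<in> S_inf. dual_coeff v (divided_difference i f) = 0"
          using f i by (simp add: dual_coeff_divided_difference S_inf_swap_pos)
        moreover have "\<forall>a \<in> Poly_Mapping.keys (divided_difference i f). total_degree a < D"
          using f(3) by (metis Suc_less_eq total_degree_divided_difference)
        ultimately show ?thesis using Suc.IH by blast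
      qed
      then have "a = 0" if "a \<in> Poly_Mapping.keys f" for a
        using symmetric_imp_keys_0[OF f(1) _ that] by (simp add: divided_difference_eq_0_iff)
      moreover have "0 \<notin> Poly_Mapping.keys f"
        using f(2)[rule_format, OF id_in_S_inf] by (simp add: in_keys_iff)
      ultimately have "Poly_Mapping.keys f = {}" by blast
      then show "f = 0" by simp
    qed
  qed
  from this[of "Suc (Max (total_degree ` Poly_Mapping.keys f))"] assms show ?thesis
    by (auto simp: less_Suc_eq_le)
qed

section \<open>The staircase monomial and the longest permutation\<close>

definition monomial_of :: "nat \<Rightarrow> (nat \<Rightarrow> nat) \<Rightarrow> (nat \<Rightarrow>\<^sub>0 nat)" where
  "monomial_of n e = (\<Sum>i\<in>{1..n}. Poly_Mapping.single i (e i))"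

lemma lookup_monomial_of: "Poly_Mapping.lookup (monomial_of n e) k = (if k \<in> {1..n} then e k else 0)"
  unfolding monomial_of_def lookup_sum lookup_single when_def by (simp add: sum.delta)

lemma prod_var_power: "(\<Prod>i\<in>{1..n}. var i ^ e i) = frag_of (monomial_of n e)"
proof -
  have "finite T \<Longrightarrow> (\<Prod>i\<in>T. var i ^ e i) = frag_of (\<Sum>i\<in>T. Poly_Mapping.single i (e i))" for T
    by (induction T rule: finite_induct) (simp_all add: var_power frag_of_mult)
  then show ?thesis by (simp add: monomial_of_def)
qed

lemma divided_difference_frag_of:
  assumes "Poly_Mapping.lookup a i = Suc (Poly_Mapping.lookup a (Suc i))"
  shows "divided_difference i (frag_of a) =
    frag_of (exp_part i a (Poly_Mapping.lookup a (Suc i)) (Poly_Mapping.lookup a (Suc i)))"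
  using assms by (simp add: divided_difference_eq_frag_extend dd_mono_def Let_def)

text \<open>The staircase of n + 1 is reduced to that of n by divided differences at positions 1,
  ..., n in this order. At each of them the two exponents differ by exactly one, so the result is
  again a single monomial with coefficient 1.\<close>

lemma dual_coeff_longest_perm: "dual_coeff (longest_perm n) (frag_of (monomial_of n (\<lambda>i. n - i))) = 1"
proof (induction n)
  case 0
  have "longest_perm 0 = id" by (auto simp: longest_perm_def)
  then show ?case by (simp only: dual_coeff_id) (simp add: monomial_of_def)
next
  case (Suc n)
  \<comment> \<open>\<open>u k\<close> and \<open>e k\<close> are the permutation and the exponents
    after k steps: the value n + 1 has moved from position 1 to position k + 1, and the first k
    exponents have been lowered by one.\<close>
  define u where "u k j = (if j \<in> {1..k} then n + 1 - j else if j = Suc k then Suc n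
      else if j \<in> {k+2..Suc n} then n + 2 - j else j)" for k j :: nat
  define e where "e k i = (if i \<le> k then n - i else Suc n - i)" for k i :: nat
  have "u k \<in> S_inf \<and> dual_coeff (u 0) (frag_of (monomial_of (Suc n) (e 0))) =
      dual_coeff (u k) (frag_of (monomial_of (Suc n) (e k)))" if "k \<le> n" for k
    using that
  proof (induction k)
    case 0
    have "u 0 = longest_perm (Suc n)" by (auto simp: u_def longest_perm_def fun_eq_iff)
    then show ?case using longest_perm_permutes permutes_in_S_inf by metis
  next
    case (Suc k)
    then have k: "k < n" and uk: "u k \<in> S_inf" by auto
    have u: "u (Suc k) = swap_pos (u k) (Suc k)"
      using k by (auto simp: u_def fun_eq_iff Transposition.transpose_def)
    have "dual_coeff (u k) (frag_of (monomial_of (Suc n) (e k))) =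
        dual_coeff (u (Suc k)) (divided_difference (Suc k) (frag_of (monomial_of (Suc n) (e k))))"
      unfolding u using k by (intro dual_coeff_step[where w = "u k"] uk) (auto simp: u_def)
    also have "divided_difference (Suc k) (frag_of (monomial_of (Suc n) (e k))) =
        frag_of (exp_part (Suc k) (monomial_of (Suc n) (e k)) (n - Suc k) (n - Suc k))"
      using k by (subst divided_difference_frag_of) (auto simp: lookup_monomial_of e_def)
    also have "exp_part (Suc k) (monomial_of (Suc n) (e k)) (n - Suc k) (n - Suc k) =
        monomial_of (Suc n) (e (Suc k))"
      using k by (intro poly_mapping_eqI) (auto simp: lookup_monomial_of lookup_exp_part e_def)
    finally show ?case using Suc S_inf_swap_pos[OF uk, of "Suc k"] unfolding u[symmetric] by simp
  qed
  from this[of n] have "dual_coeff (u 0) (frag_of (monomial_of (Suc n) (e 0))) =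
      dual_coeff (u n) (frag_of (monomial_of (Suc n) (e n)))" by simp
  moreover have "u 0 = longest_perm (Suc n)" "u n = longest_perm n"
    by (auto simp: u_def longest_perm_def fun_eq_iff)
  moreover have "monomial_of (Suc n) (e 0) = monomial_of (Suc n) (\<lambda>i. Suc n - i)"
    "monomial_of (Suc n) (e n) = monomial_of n (\<lambda>i. n - i)"
    by (auto intro!: poly_mapping_eqI simp: lookup_monomial_of e_def)
  ultimately show ?case using Suc.IH by simp
qed

text \<open>A permutation with nonzero value lies in S_n, and by homogeneity it has the same length
  as \<open>longest_perm n\<close>, which is the only element of maximal length.\<close>

lemma dual_coeff_staircase_monomial:
  assumes "v \<in> S_inf"
  shows "dual_coeff v (\<Prod>i\<in>{1..n}. var i ^ (n - i)) = (if v = longest_perm n then 1 else 0)"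
proof -
  let ?a = "monomial_of n (\<lambda>i. n - i)"
  have P: "(\<Prod>i\<in>{1..n}. var i ^ (n - i)) = frag_of ?a" by (rule prod_var_power)
  have "v = longest_perm n" if nz: "dual_coeff v (frag_of ?a) \<noteq> 0"
  proof (rule ccontr)
    assume ne: "v \<noteq> longest_perm n"
    have "frag_of ?a \<in> staircase n" by (auto simp: staircase_def keys_frag_of lookup_monomial_of)
    then have "v permutes {1..n}" using dual_coeff_eq_0_outside assms nz by blast
    then have "len v < len (longest_perm n)" using ne by (rule len_less_longest_perm)
    also have "len (longest_perm n) = total_degree ?a"
      using dual_coeff_longest_perm[of n]
      by (intro dual_coeff_homogeneous[where f = "frag_of ?a"])
         (auto simp: keys_frag_of intro: permutes_in_S_inf longest_perm_permutes)
    also have "\<dots> = len v"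
      using assms nz by (intro dual_coeff_homogeneous[symmetric]) (auto simp: keys_frag_of)
    finally show False by (rule less_irrefl[THEN notE])
  qed
  then have "dual_coeff v (frag_of ?a) = 0" if "v \<noteq> longest_perm n"
    using that by blast
  then show ?thesis
    unfolding P using dual_coeff_longest_perm[of n] by (simp only: split: if_split) blast
qed

subsection \<open>Schubert polynomials\<close>

lemma is_schubert_swap_pos:
  "is_schubert w f \<Longrightarrow> 1 \<le> i \<Longrightarrow> w (Suc i) < w i \<Longrightarrow> is_schubert (swap_pos w i) (divided_difference i f)"
  unfolding swap_pos_def by (rule is_schubert.descent)

text \<open>In the descent step the value at \<open>v\<close> is either 0 or the value of
  \<open>f\<close> at \<open>swap_pos v i\<close>, which is 1 only for
  \<open>swap_pos v i = w\<close>.\<close>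

lemma is_schubert_dual_coeff:
  assumes "is_schubert w f"
  shows "w \<in> S_inf \<and> (\<exists>m. f \<in> staircase m) \<and> (\<forall>v \<in> S_inf. dual_coeff v f = (if v = w then 1 else 0))"
  using assms
proof (induction rule: is_schubert.induct)
  case (longest n)
  have "(\<Prod>i\<in>{1..n}. var i ^ (n - i)) \<in> staircase n"
    unfolding prod_var_power by (auto simp: staircase_def keys_frag_of lookup_monomial_of)
  then show ?case
    using dual_coeff_staircase_monomial permutes_in_S_inf[OF longest_perm_permutes] by blast
next
  case (descent w f i)
  then obtain m where w: "w \<in> S_inf" and m: "f \<in> staircase m"
    and d: "\<And>v. v \<in> S_inf \<Longrightarrow> dual_coeff v f = (if v = w then 1 else 0)" by blast
  have "dual_coeff v (divided_difference i f) = (if v = swap_pos w i then 1 else 0)" if v: "v \<in> S_inf" for v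
  proof -
    have "swap_pos v i = w \<longleftrightarrow> v = swap_pos w i" by (metis swap_pos_swap_pos)
    moreover have "swap_pos w i i < swap_pos w i (Suc i)" using descent by simp
    ultimately show ?thesis
      using dual_coeff_divided_difference[OF v \<open>i \<ge> 1\<close>, of f] d[OF S_inf_swap_pos[OF v \<open>i \<ge> 1\<close>]] by auto
  qed
  then show ?case
    unfolding swap_pos_def[symmetric] using S_inf_swap_pos[OF w \<open>i \<ge> 1\<close>] staircase_divided_difference[OF m \<open>i \<ge> 1\<close>] by blast
qed

lemma is_schubert_unique:
  assumes "is_schubert w f" "is_schubert w g"
  shows "f = g"
proof -
  note f = is_schubert_dual_coeff[OF assms(1)] and g = is_schubert_dual_coeff[OF assms(2)]
  from f g obtain m n where "f \<in> staircase m" "g \<in> staircase n" by blast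
  then have "f - g \<in> staircase (max m n)"
    by (intro staircase_diff) (auto elim: staircase_mono)
  then have "f - g = 0"
    by (rule dual_coeff_separates) (use f g in \<open>simp add: dual_coeff_diff\<close>)
  then show ?thesis by simp
qed

text \<open>Induction on the distance in length from \<open>longest_perm n\<close>: climb at an
  ascent inside S_n, then return by one divided difference. Starting from this n gives membership in
  \<open>staircase n\<close>.\<close>

lemma is_schubert_exists:
  assumes "w permutes {1..n}"
  shows "\<exists>f \<in> staircase n. is_schubert w f"
  using assms
proof (induction "len (longest_perm n) - len w" arbitrary: w rule: less_induct)
  case less
  show ?case
  proof (cases "w = longest_perm n")
    case True
    have "(\<Prod>i\<in>{1..n}. var i ^ (n - i)) \<in> staircase n"
      unfolding prod_var_power by (auto simp: staircase_def keys_frag_of lookup_monomial_of)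
    then show ?thesis using True is_schubert.longest by blast
  next
    case False
    with less.prems obtain i where i: "1 \<le> i" "i < n" "w i < w (Suc i)" by (rule exists_ascent)
    have l: "len (swap_pos w i) = Suc (len w)"
      using i less.prems by (intro len_swap_pos_ascent permutes_in_S_inf)
    have p: "swap_pos w i permutes {1..n}" using i less.prems by (intro permutes_swap_pos)
    have "\<exists>f \<in> staircase n. is_schubert (swap_pos w i) f"
      using l len_le_longest_perm[OF p] by (intro less.hyps p) simp
    then obtain f where f: "f \<in> staircase n" "is_schubert (swap_pos w i) f" by blast
    have "is_schubert (swap_pos (swap_pos w i) i) (divided_difference i f)"
      using f(2) i by (intro is_schubert_swap_pos) auto
    then show ?thesis using staircase_divided_difference[OF f(1) i(1)] by auto
  qed
qed

lemma is_schubert_schubert: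
  assumes "w \<in> S_inf"
  shows "is_schubert w (schubert w)"
proof -
  from assms obtain n where "w permutes {1..n}" by (auto simp: S_inf_def)
  then obtain f where "is_schubert w f" using is_schubert_exists by blast
  then show ?thesis unfolding schubert_def by (rule theI) (rule is_schubert_unique[OF _ \<open>is_schubert w f\<close>])
qed

lemma schubert_in_staircase: "w permutes {1..n} \<Longrightarrow> schubert w \<in> staircase n"
  using is_schubert_exists[of w n] is_schubert_schubert[of w] permutes_in_S_inf[of w n]
    is_schubert_unique[of w "schubert w"] by blast

lemma dual_coeff_schubert:
  "w \<in> S_inf \<Longrightarrow> v \<in> S_inf \<Longrightarrow> dual_coeff v (schubert w) = (if v = w then 1 else 0)"
  using is_schubert_dual_coeff[OF is_schubert_schubert] by blast

text \<open>If \<open>v\<close> has an ascent at \<open>i\<close>, then \<open>swap_pos v i\<close>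
  has a descent there and differs from \<open>w\<close>. So every functional vanishes on this
  divided difference.\<close>

lemma divided_difference_schubert_eq_0:
  assumes "w \<in> S_inf" "1 \<le> i" "w i < w (Suc i)"
  shows "divided_difference i (schubert w) = 0"
proof -
  obtain n where n: "w permutes {1..n}" using assms by (auto simp: S_inf_def)
  show ?thesis
  proof (rule dual_coeff_separates)
    show "divided_difference i (schubert w) \<in> staircase n"
      using n assms by (intro staircase_divided_difference schubert_in_staircase)
    fix v assume v: "v \<in> S_inf"
    have "swap_pos v i \<noteq> w" if "v i < v (Suc i)" using that assms by auto
    then show "dual_coeff v (divided_difference i (schubert w)) = 0"
      using v assms by (simp add: dual_coeff_divided_difference dual_coeff_schubert S_inf_swap_pos)
  qed
qed

section \<open>Structure constants and a polynomial criterion for \<open>FS\<close>\<close>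

text \<open>Both sides agree under every functional: inside S_m by duality, outside because both
  values are 0.\<close>

lemma schubert_expansion:
  assumes "f \<in> staircase m"
  shows "f = (\<Sum>w | w permutes {1..m}. of_int (dual_coeff w f) * schubert w)"
proof -
  let ?T = "{w. w permutes {1..m}}"
  have fin: "finite ?T" by (rule finite_permutations) simp
  have "f - (\<Sum>w\<in>?T. of_int (dual_coeff w f) * schubert w) = 0"
  proof (rule dual_coeff_separates)
    show "f - (\<Sum>w\<in>?T. of_int (dual_coeff w f) * schubert w) \<in> staircase m"
      using assms by (intro staircase_diff staircase_sum staircase_of_int) (auto intro: schubert_in_staircase)
    fix v assume v: "v \<in> S_inf"
    have "dual_coeff v (\<Sum>w\<in>?T. of_int (dual_coeff w f) * schubert w) =
        (\<Sum>w\<in>?T. if v = w then dual_coeff w f else 0)"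
      unfolding dual_coeff_sum dual_coeff_of_int using v
      by (intro sum.cong) (auto simp: dual_coeff_schubert permutes_in_S_inf)
    also have "\<dots> = (if v \<in> ?T then dual_coeff v f else 0)"
      using fin by (simp add: sum.delta)
    also have "\<dots> = dual_coeff v f"
      using dual_coeff_eq_0_outside[OF v assms] by auto
    finally show "dual_coeff v (f - (\<Sum>w\<in>?T. of_int (dual_coeff w f) * schubert w)) = 0"
      by (simp add: dual_coeff_diff)
  qed
  then show ?thesis by simp
qed

text \<open>Applying \<open>dual_coeff x\<close> to any admissible expansion returns its coefficient
  at \<open>x\<close>, which gives uniqueness; outside \<open>S_inf\<close> the support condition
  forces the value 0.\<close>

lemma schubert_coeff_eq:
  assumes "u \<in> S_inf" "v \<in> S_inf"
  shows "schubert_coeff u v = (\<lambda>w. if w \<in> S_inf then dual_coeff w (schubert u * schubert v) else 0)"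
    (is "_ = ?c")
proof -
  let ?f = "schubert u * schubert v"
  obtain m n where mn: "u permutes {1..m}" "v permutes {1..n}" using assms by (auto simp: S_inf_def)
  then have f: "?f \<in> staircase (m + n)" by (intro staircase_mult schubert_in_staircase)
  let ?T = "{w. w permutes {1..m + n}}"
  have fin: "finite ?T" by (rule finite_permutations) simp
  have sub: "{w. ?c w \<noteq> 0} \<subseteq> ?T" using dual_coeff_eq_0_outside[OF _ f] by auto
  show ?thesis
    unfolding schubert_coeff_def
  proof (rule the_equality)
    have "?f = (\<Sum>w\<in>?T. of_int (?c w) * schubert w)"
      by (subst schubert_expansion[OF f]) (rule sum.cong, simp_all add: permutes_in_S_inf[of _ "m + n", simplified])
    also have "\<dots> = (\<Sum>w | ?c w \<noteq> 0. of_int (?c w) * schubert w)"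
      using sub fin by (intro sum.mono_neutral_right) auto
    finally show "finite {w. ?c w \<noteq> 0} \<and> {w. ?c w \<noteq> 0} \<subseteq> S_inf \<and>
        ?f = (\<Sum>w | ?c w \<noteq> 0. of_int (?c w) * schubert w)"
      using finite_subset[OF sub fin] by auto
  next
    fix c assume c: "finite {w. c w \<noteq> 0} \<and> {w. c w \<noteq> 0} \<subseteq> S_inf \<and>
        ?f = (\<Sum>w | c w \<noteq> 0. of_int (c w) * schubert w)"
    show "c = ?c"
    proof
      fix x
      show "c x = ?c x"
      proof (cases "x \<in> S_inf")
        case True
        have "dual_coeff x ?f = (\<Sum>w | c w \<noteq> 0. c w * dual_coeff x (schubert w))"
          using c by (simp add: dual_coeff_sum dual_coeff_of_int)
        also have "\<dots> = (\<Sum>w | c w \<noteq> 0. if x = w then c w else 0)"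
          using c True by (intro sum.cong) (auto simp: dual_coeff_schubert)
        also have "\<dots> = c x" using c by (simp add: sum.delta)
        finally show ?thesis using True by simp
      qed (use c in auto)
    qed
  qed
qed

text \<open>If only permutations in S_m occur, the expansion is a sum of elements of
  \<open>staircase m\<close>; conversely, membership in \<open>staircase m\<close> kills the
  functionals of all other permutations.\<close>

lemma FS_eq_Least_staircase:
  assumes "u \<in> S_inf" "v \<in> S_inf"
  shows "FS u v = (LEAST m. 1 \<le> m \<and> schubert u * schubert v \<in> staircase m)"
proof -
  let ?f = "schubert u * schubert v"
  obtain k n where kn: "u permutes {1..k}" "v permutes {1..n}" using assms by (auto simp: S_inf_def)
  then have f: "?f \<in> staircase (k + n)" by (intro staircase_mult schubert_in_staircase)
  have "(\<forall>w \<in> S_inf. schubert_coeff u v w \<noteq> 0 \<longrightarrow> w permutes {1..m}) \<longleftrightarrow> ?f \<in> staircase m" for m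
  proof
    assume "?f \<in> staircase m"
    then show "\<forall>w \<in> S_inf. schubert_coeff u v w \<noteq> 0 \<longrightarrow> w permutes {1..m}"
      using dual_coeff_eq_0_outside by (auto simp: schubert_coeff_eq[OF assms])
  next
    assume *: "\<forall>w \<in> S_inf. schubert_coeff u v w \<noteq> 0 \<longrightarrow> w permutes {1..m}"
    have "(\<Sum>w | w permutes {1..k + n}. of_int (dual_coeff w ?f) * schubert w) \<in> staircase m"
    proof (rule staircase_sum)
      fix w assume "w \<in> {w. w permutes {1..k + n}}"
      then have "w \<in> S_inf" by (auto intro: permutes_in_S_inf)
      then show "of_int (dual_coeff w ?f) * schubert w \<in> staircase m"
        using *[unfolded schubert_coeff_eq[OF assms]]
        by (cases "dual_coeff w ?f = 0") (simp, intro staircase_of_int schubert_in_staircase, auto)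
    qed
    then show "?f \<in> staircase m" using schubert_expansion[OF f] by simp
  qed
  then show ?thesis unfolding FS_def by simp
qed

subsection \<open>Schubert polynomials of Grassmannian permutations\<close>

text \<open>The degree in x_i as a relation: since the maximum must be attained, it also says that
  \<open>f\<close> is nonzero.\<close>

definition max_exponent :: "nat \<Rightarrow> ipoly \<Rightarrow> nat \<Rightarrow> bool" where
  "max_exponent i f d \<longleftrightarrow> (\<forall>a \<in> Poly_Mapping.keys f. Poly_Mapping.lookup a i \<le> d) \<and>
     (\<exists>a \<in> Poly_Mapping.keys f. Poly_Mapping.lookup a i = d)"

text \<open>\<open>top d f\<close> collects the terms of exponent d in x_i. The product of the two
  top parts is nonzero, and the remaining products have smaller exponents in x_i, so they cannot
  cancel it.\<close>

lemma max_exponent_mult: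
  assumes "max_exponent i f d" "max_exponent i g e"
  shows "max_exponent i (f * g) (d + e)"
proof -
  define top where "top d f = Poly_Mapping.mapp (\<lambda>a c. if Poly_Mapping.lookup a i = d then c else 0) f"
    for d and f :: ipoly
  have lookup_top: "Poly_Mapping.lookup (top d f) a = (if Poly_Mapping.lookup a i = d then Poly_Mapping.lookup f a else 0)"
    for d f a by (auto simp: top_def lookup_mapp when_def in_keys_iff)
  have keys_top: "a \<in> Poly_Mapping.keys (top d f) \<longleftrightarrow> a \<in> Poly_Mapping.keys f \<and> Poly_Mapping.lookup a i = d"
    for d f a by (simp add: in_keys_iff lookup_top)
  have keys_low: "a \<in> Poly_Mapping.keys (f - top d f) \<longleftrightarrow> a \<in> Poly_Mapping.keys f \<and> Poly_Mapping.lookup a i \<noteq> d"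
    for d f a by (simp add: in_keys_iff lookup_top lookup_minus)
  have le: "Poly_Mapping.lookup c i \<le> k + l"
    if c: "c \<in> Poly_Mapping.keys (p * q)" and "\<forall>a \<in> Poly_Mapping.keys p. Poly_Mapping.lookup a i \<le> k"
      "\<forall>a \<in> Poly_Mapping.keys q. Poly_Mapping.lookup a i \<le> l" for c k l and p q :: ipoly
  proof -
    obtain a b where "a \<in> Poly_Mapping.keys p" "b \<in> Poly_Mapping.keys q" "c = a + b"
      using keys_mult[of p q] c by blast
    then show ?thesis using that(2,3) by (simp add: lookup_add add_mono)
  qed
  have "top d f \<noteq> 0" "top e g \<noteq> 0"
    using assms keys_top[of _ d f] keys_top[of _ e g] unfolding max_exponent_def
    by (metis keys_zero empty_iff)+
  then have "top d f * top e g \<noteq> 0" by simp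
  then obtain c where c: "c \<in> Poly_Mapping.keys (top d f * top e g)"
    using keys_eq_empty by blast
  then obtain a b where "a \<in> Poly_Mapping.keys (top d f)" "b \<in> Poly_Mapping.keys (top e g)" "c = a + b"
    using keys_mult[of "top d f" "top e g"] by blast
  then have ci: "Poly_Mapping.lookup c i = d + e" by (simp add: keys_top lookup_add)
  have "c \<notin> Poly_Mapping.keys (top d f * (g - top e g))"
  proof
    assume "c \<in> Poly_Mapping.keys (top d f * (g - top e g))"
    then obtain a b where "a \<in> Poly_Mapping.keys (top d f)" "b \<in> Poly_Mapping.keys (g - top e g)" "c = a + b"
      using keys_mult[of "top d f" "g - top e g"] by blast
    then show False using assms(2) ci
      by (auto simp: keys_top keys_low lookup_add max_exponent_def)
  qed
  moreover have "c \<notin> Poly_Mapping.keys ((f - top d f) * g)"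
  proof
    assume "c \<in> Poly_Mapping.keys ((f - top d f) * g)"
    then obtain a b where ab: "a \<in> Poly_Mapping.keys (f - top d f)" "b \<in> Poly_Mapping.keys g" "c = a + b"
      using keys_mult[of "f - top d f" g] by blast
    then have "Poly_Mapping.lookup a i < d" "Poly_Mapping.lookup b i \<le> e"
      using assms by (auto simp: keys_low max_exponent_def le_neq_implies_less)
    then show False using ci ab(3) by (simp add: lookup_add)
  qed
  moreover have "f * g = top d f * top e g + top d f * (g - top e g) + (f - top d f) * g"
    by (simp add: algebra_simps)
  then have "Poly_Mapping.lookup (f * g) c = Poly_Mapping.lookup (top d f * top e g) c +
      Poly_Mapping.lookup (top d f * (g - top e g)) c + Poly_Mapping.lookup ((f - top d f) * g) c"
    by (simp only: lookup_add)
  ultimately have "c \<in> Poly_Mapping.keys (f * g)" using c by (simp add: in_keys_iff)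
  then show ?thesis
    using ci le[of _ f g d e] assms unfolding max_exponent_def by blast
qed

lemma staircase_iff_max_exponent:
  assumes "\<And>j. max_exponent j f (e j)"
  shows "f \<in> staircase m \<longleftrightarrow> (\<forall>j. e j \<le> (if j = 0 then 0 else m - j))"
proof
  assume "f \<in> staircase m"
  then show "\<forall>j. e j \<le> (if j = 0 then 0 else m - j)"
    using assms staircaseD unfolding max_exponent_def by metis
next
  assume "\<forall>j. e j \<le> (if j = 0 then 0 else m - j)"
  then show "f \<in> staircase m"
    using assms unfolding staircase_def max_exponent_def by (blast intro: order_trans)
qed

lemma schubert_id: "schubert id = 1"
proof -
  have "longest_perm 0 = id" by (auto simp: longest_perm_def)
  then have "is_schubert id 1" using is_schubert.longest[of 0] by simp
  then show ?thesis using is_schubert_unique is_schubert_schubert id_in_S_inf by blast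
qed

lemma symmetric_imp_exponent_everywhere:
  assumes "\<And>i. 1 \<le> i \<Longrightarrow> i < m \<Longrightarrow> swap_vars i f = f" "a \<in> Poly_Mapping.keys f" "j \<in> {1..m}" "k \<in> {1..m}"
  shows "\<exists>b \<in> Poly_Mapping.keys f. Poly_Mapping.lookup b k = Poly_Mapping.lookup a j"
proof -
  have up: "\<exists>b \<in> Poly_Mapping.keys f. Poly_Mapping.lookup b k = Poly_Mapping.lookup a j"
    if "j \<le> k" "k \<le> m" "1 \<le> j" for j k
    using that
  proof (induction k rule: dec_induct)
    case base
    then show ?case using assms(2) by blast
  next
    case (step k)
    then obtain b where b: "b \<in> Poly_Mapping.keys f" "Poly_Mapping.lookup b k = Poly_Mapping.lookup a j"
      by auto
    have "swap_exp k b \<in> Poly_Mapping.keys f"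
      using step b by (intro swap_exp_in_keys assms(1)) auto
    moreover have "Poly_Mapping.lookup (swap_exp k b) (Suc k) = Poly_Mapping.lookup a j"
      using b by (simp add: lookup_swap_exp)
    ultimately show ?case by blast
  qed
  have down: "\<exists>b \<in> Poly_Mapping.keys f. Poly_Mapping.lookup b k = Poly_Mapping.lookup a j"
    if "k \<le> j" "j \<le> m" "1 \<le> k" for j k
    using that
  proof (induction k rule: inc_induct)
    case base
    then show ?case using assms(2) by blast
  next
    case (step k)
    then obtain b where b: "b \<in> Poly_Mapping.keys f" "Poly_Mapping.lookup b (Suc k) = Poly_Mapping.lookup a j"
      by auto
    have "swap_exp k b \<in> Poly_Mapping.keys f"
      using step b by (intro swap_exp_in_keys assms(1)) auto
    moreover have "Poly_Mapping.lookup (swap_exp k b) k = Poly_Mapping.lookup a j"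
      using b by (simp add: lookup_swap_exp)
    ultimately show ?case by blast
  qed
  show ?thesis using up[of j k] down[of k j] assms(3,4) by (cases "j \<le> k") auto
qed

text \<open>Let n be minimal with \<open>w\<close> in S_n, so that n is not fixed. After position m
  the values increase up to fixed points, hence w j <= j there, and the value n must sit at a
  position up to m. As \<open>w\<close> increases on these, w m = n.\<close>

lemma single_descent_support:
  assumes "w \<in> S_inf" and desc: "w (Suc m) < w m" and asc: "\<And>i. i \<noteq> m \<Longrightarrow> w i < w (Suc i)"
  shows "w permutes {1..w m}" "\<not> w permutes {1..w m - 1}" "m < w m"
proof -
  from assms(1) have ex: "\<exists>n. w permutes {1..n}" by (auto simp: S_inf_def)
  define n where "n = (LEAST n. w permutes {1..n})"
  have n: "w permutes {1..n}" unfolding n_def using ex by (rule LeastI_ex)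
  have least: "\<not> w permutes {1..k}" if "k < n" for k
    using that unfolding n_def by (rule not_less_Least)
  have fixed: "w k = k" if "n < k" for k using n that by (intro permutes_not_in) auto
  have "n \<noteq> 0"
  proof
    assume "n = 0"
    then have "w = id" using n by simp
    then show False using desc by simp
  qed
  have wn: "w n \<noteq> n"
  proof
    assume "w n = n"
    then have "w permutes {1..n - 1}"
      by (intro permutes_superset[OF n]) (metis Diff_iff One_nat_def Suc_pred \<open>n \<noteq> 0\<close> atLeastAtMost_iff le_Suc_eq neq0_conv)
    then show False using least[of "n - 1"] \<open>n \<noteq> 0\<close> by simp
  qed
  have inc: "w j + (k - j) \<le> w k" if "j \<le> k" "k \<le> m \<or> m < j" for j k
    using that
  proof (induction k rule: dec_induct)
    case (step k)
    then have "w k < w (Suc k)" by (intro asc) auto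
    with step show ?case by auto
  qed simp
  \<comment> \<open>Compare with position j + n + 1, which is fixed: increments of at least one
    leave no room for w j > j.\<close>
  have le: "w j \<le> j" if "m < j" for j
    using inc[of j "j + Suc n"] that fixed[of "j + Suc n"] by simp
  have "m < n"
  proof (rule ccontr)
    assume "\<not> m < n"
    then have "w (Suc m) = Suc m" by (intro fixed) simp
    moreover have "w m \<le> m"
      using permutes_in_image[OF n, of m] fixed[of m] \<open>\<not> m < n\<close> \<open>n \<noteq> 0\<close> by (cases "n < m") auto
    ultimately show False using desc by simp
  qed
  obtain j where j: "w j = n" using n by (metis permutes_surj surj_def)
  have "j \<in> {1..n}" using permutes_in_image[OF n, of j] j \<open>n \<noteq> 0\<close> by simp
  then have "j \<le> m" using le[of j] j wn by (cases "j = n") (auto simp: not_less[symmetric])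
  then have "n \<le> w m" using inc[of j m] j by simp
  moreover have "w m \<le> n"
    using permutes_in_image[OF n, of m] \<open>m < n\<close> permutes_1_0[OF n] by (cases m) auto
  ultimately have "w m = n" by simp
  then show "w permutes {1..w m}" "\<not> w permutes {1..w m - 1}" "m < w m"
    using n least[of "n - 1"] \<open>n \<noteq> 0\<close> \<open>m < n\<close> by auto
qed

text \<open>The Schubert polynomial is a Schur polynomial in \<open>x\<^sub>1, \<dots>, x\<^sub>m\<close> of a partition with largest
  part \<open>w m - m\<close>. Only its symmetry and its position in the filtration by \<open>staircase\<close> are needed
  to read off the exponents.\<close>

lemma max_exponent_single_descent:
  assumes "w \<in> S_inf" and desc: "w (Suc m) < w m" and asc: "\<And>i. i \<noteq> m \<Longrightarrow> w i < w (Suc i)"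
  shows "max_exponent j (schubert w) (if j \<in> {1..m} then w m - m else 0)"
proof -
  define n where "n = w m"
  let ?f = "schubert w"
  note supp = single_descent_support[OF assms, folded n_def]
  have f: "?f \<in> staircase n" using supp(1) by (rule schubert_in_staircase)
  have m: "1 \<le> m" using descent_pos[OF assms(1) desc] .
  have sym: "swap_vars i ?f = ?f" if "1 \<le> i" "i \<noteq> m" for i
    using divided_difference_schubert_eq_0[OF assms(1) that(1) asc[OF that(2)]]
    by (simp add: divided_difference_eq_0_iff)
  have zero: "Poly_Mapping.lookup a k = 0" if "a \<in> Poly_Mapping.keys ?f" "m < k" for a k
    using symmetric_imp_lookup_0[OF f sym that(1), of "Suc m" k] that(2) by simp
  have move: "\<exists>b \<in> Poly_Mapping.keys ?f. Poly_Mapping.lookup b k = Poly_Mapping.lookup a j"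
    if "a \<in> Poly_Mapping.keys ?f" "j \<in> {1..m}" "k \<in> {1..m}" for a j k
    using that by (intro symmetric_imp_exponent_everywhere[where m = m] sym) auto
  have upper: "Poly_Mapping.lookup a k \<le> n - m" if ak: "a \<in> Poly_Mapping.keys ?f" "k \<in> {1..m}" for a k
  proof -
    have "m \<in> {1..m}" using m by simp
    then obtain b where "b \<in> Poly_Mapping.keys ?f" "Poly_Mapping.lookup b m = Poly_Mapping.lookup a k"
      using move[OF ak] by blast
    then show ?thesis using staircaseD[OF f, of b m] m by simp
  qed
  \<comment> \<open>The functional of \<open>w\<close> is 1 on its own Schubert polynomial but
    vanishes on \<open>staircase (n - 1)\<close>. So some exponent at i <= m exceeds n - 1 - i >= n
    - 1 - m, which makes the bound n - m sharp.\<close>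
  have "?f \<notin> staircase (n - 1)"
    using dual_coeff_eq_0_outside[OF assms(1) _ supp(2)] dual_coeff_schubert[OF assms(1) assms(1)] by auto
  then obtain a i where a: "a \<in> Poly_Mapping.keys ?f" "(if i = 0 then 0 else n - 1 - i) < Poly_Mapping.lookup a i"
    unfolding staircase_def by (auto simp: not_le)
  have i: "i \<in> {1..m}"
    using a zero[OF a(1), of i] staircaseD[OF f a(1), of i] by (cases "m < i"; cases "i = 0") auto
  have ai: "Poly_Mapping.lookup a i = n - m"
    using upper[OF a(1) i] a(2) i supp(3) by auto
  show ?thesis
  proof (cases "j \<in> {1..m}")
    case True
    obtain b where "b \<in> Poly_Mapping.keys ?f" "Poly_Mapping.lookup b j = n - m"
      using move[OF a(1) i True] ai by auto
    then show ?thesis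
      using upper[OF _ True] True by (auto simp: max_exponent_def n_def)
  next
    case False
    have "Poly_Mapping.lookup b j = 0" if "b \<in> Poly_Mapping.keys ?f" for b
      using False zero[OF that, of j] staircaseD[OF f that, of j] by (cases "j = 0") auto
    then show ?thesis using a(1) False by (auto simp: max_exponent_def)
  qed
qed

section \<open>The descent position and the formula for \<open>FS\<close>\<close>

text \<open>The value 0 for the identity makes the range {1..0} empty, so the degree formula and
  \<open>first_values\<close> cover the identity as well.\<close>

definition descent_position :: "(nat \<Rightarrow> nat) \<Rightarrow> nat" where
  "descent_position w = (if w = id then 0 else (LEAST i. w (Suc i) < w i))"

lemma descent_position_id [simp]: "descent_position id = 0"
  by (simp add: descent_position_def)

lemma grassmannian_in_S_inf: "w \<in> grassmannian_perms n \<Longrightarrow> w \<in> S_inf"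
  by (auto simp: grassmannian_perms_def S_inf_def)

lemma grassmannian_descent:
  assumes "w \<in> grassmannian_perms n" "w \<noteq> id"
  shows "w (Suc (descent_position w)) < w (descent_position w)"
    "\<And>i. i \<noteq> descent_position w \<Longrightarrow> w i < w (Suc i)"
    "descent_position w \<in> {1..<n}"
proof -
  let ?m = "descent_position w"
  let ?D = "{m \<in> {1..<n}. w m > w (Suc m)}"
  have w: "w permutes {1..n}" "w \<in> S_inf" "card ?D \<le> 1"
    using assms(1) permutes_in_S_inf by (auto simp: grassmannian_perms_def)
  have m: "?m = (LEAST i. w (Suc i) < w i)" using assms(2) by (simp add: descent_position_def)
  show desc: "w (Suc ?m) < w ?m"
    unfolding m using exists_descent[OF w(2) assms(2)] by (metis (mono_tags, lifting) LeastI)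
  have range: "i \<in> ?D" if "w (Suc i) < w i" for i
  proof -
    have "1 \<le> i" using descent_pos[OF w(2) that] .
    moreover have "i < n"
    proof (rule ccontr)
      assume "\<not> i < n"
      then have "w (Suc i) = Suc i" using w by (intro permutes_not_in) auto
      moreover have "w i \<le> i"
        using permutes_in_image[OF w(1), of i] permutes_not_in[OF w(1), of i] \<open>\<not> i < n\<close> \<open>1 \<le> i\<close>
        by (cases "n < i") auto
      ultimately show False using that by simp
    qed
    ultimately show ?thesis using that by simp
  qed
  show "?m \<in> {1..<n}" using range[OF desc] by simp
  fix i assume i: "i \<noteq> ?m"
  have "\<not> w (Suc i) < w i"
  proof
    assume "w (Suc i) < w i"
    then have "{i, ?m} \<subseteq> ?D" using range desc by blast
    then have "card {i, ?m} \<le> card ?D" by (intro card_mono) auto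
    then show False using w(3) i by simp
  qed
  then show "w i < w (Suc i)" using S_inf_inj[OF w(2)] by (metis inj_eq linorder_neqE_nat n_not_Suc_n)
qed

lemma grassmannian_max_exponent:
  assumes "w \<in> grassmannian_perms n"
  shows "max_exponent j (schubert w)
    (if j \<in> {1..descent_position w} then w (descent_position w) - descent_position w else 0)"
proof (cases "w = id")
  case True
  then show ?thesis by (simp add: schubert_id max_exponent_def)
next
  case False
  show ?thesis
    using grassmannian_descent(1,2)[OF assms False] grassmannian_in_S_inf[OF assms]
    by (intro max_exponent_single_descent) auto
qed

lemma grassmannian_descent_position_less:
  assumes "w \<in> grassmannian_perms n"
  shows "descent_position w \<le> w (descent_position w)"
    "descent_position w \<noteq> 0 \<Longrightarrow> descent_position w < w (descent_position w)"
proof -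
  show *: "descent_position w < w (descent_position w)" if "descent_position w \<noteq> 0"
  proof -
    have "w \<noteq> id" using that by auto
    then show ?thesis
      using single_descent_support(3) grassmannian_descent(1,2)[OF assms] grassmannian_in_S_inf[OF assms]
      by blast
  qed
  then show "descent_position w \<le> w (descent_position w)"
    by (cases "descent_position w = 0") auto
qed

lemma FS_commute: "u \<in> S_inf \<Longrightarrow> v \<in> S_inf \<Longrightarrow> FS u v = FS v u"
  by (simp add: FS_eq_Least_staircase mult.commute)

text \<open>In the product, x_j has degree d + c for 1 <= j <= p, c for p < j <= q and 0 otherwise,
  where d = u p - p and c = v q - q. The staircase bounds are tightest at p and q and read p + d + c
  <= m and q + c <= m. The \<open>max 1\<close> matters only for two identities.\<close>

lemma FS_grassmannian:
  assumes "u \<in> grassmannian_perms n" "v \<in> grassmannian_perms n"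
    and le: "descent_position u \<le> descent_position v"
  shows "FS u v = max 1 (max (u (descent_position u)) (descent_position v) +
    (v (descent_position v) - descent_position v))"
proof -
  define p where "p = descent_position u"
  define q where "q = descent_position v"
  define d where "d = u p - p"
  define c where "c = v q - q"
  \<comment> \<open>Positivity of d and c is what turns e j <= m - j, with truncated subtraction,
    into j + e j <= m.\<close>
  have up: "u p = p + d" and d0: "p \<noteq> 0 \<Longrightarrow> d \<noteq> 0"
    using grassmannian_descent_position_less[OF assms(1)] by (auto simp: d_def p_def)
  have c0: "q \<noteq> 0 \<Longrightarrow> c \<noteq> 0"
    using grassmannian_descent_position_less[OF assms(2)] by (auto simp: c_def q_def)
  have pq: "p \<le> q" using le by (simp add: p_def q_def)
  define e where "e j = (if j \<in> {1..p} then d else 0) + (if j \<in> {1..q} then c else 0)" for j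
  have e: "max_exponent j (schubert u * schubert v) (e j)" for j
    unfolding e_def d_def c_def p_def q_def
    by (intro max_exponent_mult grassmannian_max_exponent[OF assms(1)] grassmannian_max_exponent[OF assms(2)])
  have "FS u v = (LEAST m. 1 \<le> m \<and> (\<forall>j. e j \<le> (if j = 0 then 0 else m - j)))"
    unfolding FS_eq_Least_staircase[OF grassmannian_in_S_inf[OF assms(1)] grassmannian_in_S_inf[OF assms(2)]]
    by (simp only: staircase_iff_max_exponent[OF e])
  also have "\<dots> = max 1 (max (p + d) q + (if q = 0 then 0 else c))"
  proof (rule Least_equality)
    show "1 \<le> max 1 (max (p + d) q + (if q = 0 then 0 else c)) \<and>
        (\<forall>j. e j \<le> (if j = 0 then 0 else max 1 (max (p + d) q + (if q = 0 then 0 else c)) - j))"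
      using pq by (auto simp: e_def max_def)
  next
    fix m assume m: "1 \<le> m \<and> (\<forall>j. e j \<le> (if j = 0 then 0 else m - j))"
    have "q \<noteq> 0 \<Longrightarrow> q + c \<le> m" using m[THEN conjunct2, rule_format, of q] c0 by (auto simp: e_def split: if_splits)
    moreover have "p \<noteq> 0 \<Longrightarrow> p + d + c \<le> m"
      using m[THEN conjunct2, rule_format, of p] d0 pq by (auto simp: e_def split: if_splits)
    moreover have "p = 0 \<Longrightarrow> d = 0"
      using S_inf_0[OF grassmannian_in_S_inf[OF assms(1)]] by (simp add: d_def)
    ultimately show "max 1 (max (p + d) q + (if q = 0 then 0 else c)) \<le> m"
      using m pq by (cases "p = 0"; cases "q = 0") auto
  qed
  also have "(if q = 0 then 0 else c) = v q - q"
    using S_inf_0[OF grassmannian_in_S_inf[OF assms(2)]] by (simp add: c_def)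
  finally show ?thesis unfolding up[symmetric] by (simp add: p_def q_def)
qed

subsection \<open>Grassmannian permutations as subsets\<close>

definition first_values :: "(nat \<Rightarrow> nat) \<Rightarrow> nat set" where
  "first_values w = w ` {1..descent_position w}"

text \<open>The subsets of \<open>{1..n}\<close> that are not of the form \<open>{1..m}\<close> with \<open>m \<ge> 1\<close>; the identity
  is represented by the empty set.\<close>

definition gapped_subsets :: "nat \<Rightarrow> nat set set" where
  "gapped_subsets n = Pow {1..n} - (\<lambda>m. {1..m}) ` {1..n}"

text \<open>The value 0 at the empty set agrees with \<open>id 0 = 0\<close>, the value of the
  identity at its descent position.\<close>

definition max0 :: "nat set \<Rightarrow> nat" where
  "max0 A = Max (insert 0 A)"

text \<open>Once all earlier values agree, f k = g j is possible only for j >= k, so g k <= f k; the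
  argument is symmetric.\<close>

lemma strict_increasing_eqI:
  fixes f g :: "nat \<Rightarrow> nat"
  assumes f: "\<And>i j. i \<in> S \<Longrightarrow> j \<in> S \<Longrightarrow> i < j \<Longrightarrow> f i < f j"
    and g: "\<And>i j. i \<in> S \<Longrightarrow> j \<in> S \<Longrightarrow> i < j \<Longrightarrow> g i < g j"
    and img: "f ` S = g ` S" and "k \<in> S"
  shows "f k = g k"
  using \<open>k \<in> S\<close>
proof (induction k rule: less_induct)
  case (less k)
  have *: "a k \<le> b k"
    if ab: "b ` S \<subseteq> a ` S" "\<And>j. j < k \<Longrightarrow> j \<in> S \<Longrightarrow> a j = b j"
      and a: "\<And>i j. i \<in> S \<Longrightarrow> j \<in> S \<Longrightarrow> i < j \<Longrightarrow> a i < a j"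
      and b: "\<And>i j. i \<in> S \<Longrightarrow> j \<in> S \<Longrightarrow> i < j \<Longrightarrow> b i < b j" for a b :: "nat \<Rightarrow> nat"
  proof -
    obtain j where j: "j \<in> S" "b k = a j" using ab(1) less.prems by blast
    have "\<not> j < k" using ab(2)[OF _ j(1)] b[OF j(1) less.prems] j(2) by auto
    then show ?thesis using a[OF less.prems j(1)] j(2) by (cases "k = j") auto
  qed
  show ?case
    using *[of g f] *[of f g] less.IH f g img by (intro antisym) auto
qed

lemma increasing_chain:
  fixes w :: "nat \<Rightarrow> nat"
  assumes "\<And>i. i \<in> {a..<b} \<Longrightarrow> w i < w (Suc i)" "i \<in> {a..b}" "j \<in> {a..b}" "i < j"
  shows "w i < w j"
proof -
  have "Suc i \<le> j" using assms by simp
  then show ?thesis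
    using assms(2,3)
  proof (induction j rule: dec_induct)
    case base
    then show ?case using assms(1)[of i] by auto
  next
    case (step j)
    then show ?case using assms(1)[of j] by auto
  qed
qed

lemma grassmannian_permutes: "w \<in> grassmannian_perms n \<Longrightarrow> w permutes {1..n}"
  by (simp add: grassmannian_perms_def)

lemma grassmannian_increasing:
  assumes "w \<in> grassmannian_perms n" "i < j" "j \<le> descent_position w \<or> descent_position w < i"
  shows "w i < w j"
proof (cases "w = id")
  case False
  show ?thesis
    by (rule increasing_chain[where a = i and b = j])
      (use grassmannian_descent(2)[OF assms(1) False] assms in auto)
qed (use assms in simp)

lemma card_first_values:
  assumes "w \<in> grassmannian_perms n"
  shows "card (first_values w) = descent_position w"
  unfolding first_values_def
  using card_image[OF inj_on_subset[OF permutes_inj[OF grassmannian_permutes[OF assms]] subset_UNIV]]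
  by simp

lemma max0_first_values:
  assumes "w \<in> grassmannian_perms n"
  shows "max0 (first_values w) = w (descent_position w)"
  unfolding max0_def
proof (rule Max_eqI)
  show "finite (insert 0 (first_values w))" by (simp add: first_values_def)
  show "y \<le> w (descent_position w)" if "y \<in> insert 0 (first_values w)" for y
  proof -
    have "w i \<le> w (descent_position w)" if "i \<le> descent_position w" for i
      using grassmannian_increasing[OF assms, of i "descent_position w"] that
      by (cases "i = descent_position w") auto
    then show ?thesis using that by (auto simp: first_values_def)
  qed
  show "w (descent_position w) \<in> insert 0 (first_values w)"
    using permutes_1_0[OF grassmannian_permutes[OF assms]]
    by (cases "descent_position w = 0") (auto simp: first_values_def)
qed

text \<open>If the first values formed {1..m}, the descent would be at m with w m <= m, contrary to
  m < w m.\<close>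

lemma first_values_in_gapped:
  assumes "w \<in> grassmannian_perms n"
  shows "first_values w \<in> gapped_subsets n"
proof -
  let ?d = "descent_position w"
  note p = grassmannian_permutes[OF assms]
  have "?d \<le> n"
    using grassmannian_descent(3)[OF assms] by (cases "w = id") auto
  then have "first_values w \<subseteq> w ` {1..n}" unfolding first_values_def by (intro image_mono) auto
  also have "w ` {1..n} = {1..n}" by (rule permutes_image[OF p])
  finally have sub: "first_values w \<subseteq> {1..n}" .
  have "first_values w \<noteq> {1..m}" if m: "m \<in> {1..n}" for m
  proof
    assume eq: "first_values w = {1..m}"
    then have "?d = m" using card_first_values[OF assms] by simp
    then have "w ?d \<in> {1..?d}" using eq m unfolding first_values_def by auto
    then show False
      using grassmannian_descent_position_less(2)[OF assms] \<open>?d = m\<close> m by auto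
  qed
  then show ?thesis using sub unfolding gapped_subsets_def by blast
qed

lemma inj_on_first_values: "inj_on first_values (grassmannian_perms n)"
proof (rule inj_onI)
  fix u v assume u: "u \<in> grassmannian_perms n" and v: "v \<in> grassmannian_perms n"
    and eq: "first_values u = first_values v"
  note pu = grassmannian_permutes[OF u] and pv = grassmannian_permutes[OF v]
  let ?d = "descent_position u"
  have d: "descent_position v = ?d"
    using eq card_first_values[OF u] card_first_values[OF v] by simp
  have dn: "?d \<le> n" using grassmannian_descent(3)[OF u] by (cases "u = id") auto
  have compl: "w ` {Suc ?d..n} = {1..n} - w ` {1..?d}" if "w permutes {1..n}" for w
  proof -
    have "{Suc ?d..n} = {1..n} - {1..?d}" by auto
    then have "w ` {Suc ?d..n} = w ` {1..n} - w ` {1..?d}"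
      using image_set_diff[OF permutes_inj[OF that]] by metis
    then show ?thesis using permutes_image[OF that] by simp
  qed
  have img: "u ` {1..?d} = v ` {1..?d}" using eq d by (simp add: first_values_def)
  have "u k = v k" if "k \<in> {1..?d}" for k
    by (rule strict_increasing_eqI[OF _ _ img that])
      (auto intro: grassmannian_increasing[OF u] grassmannian_increasing[OF v] simp: d)
  moreover have "u k = v k" if "k \<in> {Suc ?d..n}" for k
  proof (rule strict_increasing_eqI[OF _ _ _ that])
    show "u ` {Suc ?d..n} = v ` {Suc ?d..n}" using compl[OF pu] compl[OF pv] img by simp
  qed (auto intro: grassmannian_increasing[OF u] grassmannian_increasing[OF v] simp: d)
  moreover have "u k = v k" if "k \<notin> {1..n}" for k
    using permutes_not_in[OF pu that] permutes_not_in[OF pv that] by simp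
  ultimately show "u = v"
    by (intro ext) (metis atLeastAtMost_iff not_less_eq_eq)
qed

lemma gapped_subset_of_first_values:
  assumes "A \<in> gapped_subsets n"
  shows "\<exists>w \<in> grassmannian_perms n. first_values w = A"
proof (cases "A = {}")
  case True
  have "id \<in> grassmannian_perms n" by (simp add: grassmannian_perms_def permutes_id)
  moreover have "first_values id = A" using True by (simp add: first_values_def)
  ultimately show ?thesis by blast
next
  case False
  have A: "A \<subseteq> {1..n}" "finite A" "\<And>m. m \<in> {1..n} \<Longrightarrow> A \<noteq> {1..m}"
    using assms finite_subset by (auto simp: gapped_subsets_def)
  define m where "m = card A"
  have m: "m \<in> {1..n}" using A False card_mono[of "{1..n}" A] by (auto simp: m_def Suc_le_eq card_gt_0_iff)
  obtain f where f: "bij_betw f {..<m} A" "strict_mono_on {..<m} f"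
    using ex_bij_betw_strict_mono_card[OF A(2)] unfolding m_def by blast
  have "card ({1..n} - A) = n - m" using A by (simp add: card_Diff_subset m_def)
  then obtain g where g: "bij_betw g {..<n - m} ({1..n} - A)" "strict_mono_on {..<n - m} g"
    using ex_bij_betw_strict_mono_card[of "{1..n} - A"] by auto
  \<comment> \<open>Increasing enumerations of \<open>A\<close> and of its complement, shifted
    because they start at 0. A descent is possible only where they meet, and it occurs because
    \<open>A\<close> is not {1..m}.\<close>
  define w where "w k = (if k \<in> {1..m} then f (k - 1) else if k \<in> {Suc m..n} then g (k - Suc m) else k)" for k
  have shift: "{1..m} = Suc ` {..<m}"
    unfolding lessThan_atLeast0 image_Suc_atLeastLessThan by auto
  have shift': "{Suc m..n} = (\<lambda>k. k + Suc m) ` {..<n - m}"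
    unfolding lessThan_atLeast0 image_add_atLeastLessThan' using m by auto
  have "w ` {1..m} = f ` {..<m}" unfolding shift image_image by (intro image_cong) (auto simp: w_def)
  then have wA: "w ` {1..m} = A" using f(1) by (simp add: bij_betw_def)
  have "w ` {Suc m..n} = g ` {..<n - m}" unfolding shift' image_image by (intro image_cong) (auto simp: w_def)
  then have wB: "w ` {Suc m..n} = {1..n} - A" using g(1) by (simp add: bij_betw_def)
  have "{1..n} = {1..m} \<union> {Suc m..n}" using m by auto
  then have img: "w ` {1..n} = {1..n}" using wA wB A(1) by (simp add: image_Un) blast
  then have "bij_betw w {1..n} {1..n}"
    by (simp add: bij_betw_def eq_card_imp_inj_on)
  then have p: "w permutes {1..n}"
    by (rule bij_imp_permutes) (use m in \<open>auto simp: w_def\<close>)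
  have asc: "w i < w (Suc i)" if "i \<in> {1..<n}" "i \<noteq> m" for i
  proof (cases "i < m")
    case True
    then show ?thesis
      using strict_mono_onD[OF f(2), of "i - 1" i] that by (auto simp: w_def)
  next
    case False
    then show ?thesis
      using strict_mono_onD[OF g(2), of "i - Suc m" "i - m"] that by (auto simp: w_def)
  qed
  then have desc_sub: "{k \<in> {1..<n}. w k > w (Suc k)} \<subseteq> {m}" by (auto simp: not_less[symmetric] dest: less_asym)
  then have "card {k \<in> {1..<n}. w k > w (Suc k)} \<le> 1"
    using card_mono[of "{m}"] by fastforce
  then have w: "w \<in> grassmannian_perms n" using p by (simp add: grassmannian_perms_def)
  have "w \<noteq> id" using wA A(3)[OF m] by auto
  then have "descent_position w \<in> {k \<in> {1..<n}. w k > w (Suc k)}"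
    using grassmannian_descent(1,3)[OF w] by simp
  then have "descent_position w = m" using desc_sub by blast
  then show ?thesis using w wA unfolding first_values_def by blast
qed

lemma bij_betw_first_values: "bij_betw first_values (grassmannian_perms n) (gapped_subsets n)"
  unfolding bij_betw_def
  using inj_on_first_values first_values_in_gapped gapped_subset_of_first_values by blast

section \<open>\<open>FS\<close> as a function of two subsets\<close>

text \<open>The formula of \<open>FS_grassmannian\<close>, with \<open>card\<close> for the descent
  position and \<open>max0\<close> for the value there; the branches are the two orders of the
  descents.\<close>

definition FS_sets :: "nat set \<Rightarrow> nat set \<Rightarrow> nat" where
  "FS_sets A B = (if card A \<le> card B then max 1 (max (max0 A) (card B) + (max0 B - card B))
     else max 1 (max (max0 B) (card A) + (max0 A - card A)))"

lemma FS_eq_FS_sets: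
  assumes "u \<in> grassmannian_perms n" "v \<in> grassmannian_perms n"
  shows "FS u v = FS_sets (first_values u) (first_values v)"
  using FS_grassmannian[OF assms] FS_grassmannian[OF assms(2,1)]
    FS_commute[OF grassmannian_in_S_inf[OF assms(1)] grassmannian_in_S_inf[OF assms(2)]]
  by (simp add: FS_sets_def card_first_values[OF assms(1)] card_first_values[OF assms(2)]
      max0_first_values[OF assms(1)] max0_first_values[OF assms(2)])

lemma finite_gapped_subsets: "finite (gapped_subsets n)"
  by (simp add: gapped_subsets_def)

lemma card_gapped_subsets: "card (gapped_subsets n) = 2 ^ n - n"
proof -
  have "inj_on (\<lambda>m::nat. {1..m}) {1..n}"
    by (rule inj_onI) (metis card_atLeastAtMost diff_Suc_1 One_nat_def)
  then have "card ((\<lambda>m. {1..m}) ` {1..n}) = n" by (simp add: card_image)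
  moreover have "(\<lambda>m. {1..m}) ` {1..n} \<subseteq> Pow {1..n}" by auto
  ultimately show ?thesis
    unfolding gapped_subsets_def by (subst card_Diff_subset) (auto simp: card_Pow)
qed

lemma card_le_max0: "finite A \<Longrightarrow> 0 \<notin> A \<Longrightarrow> card A \<le> max0 A"
proof -
  assume A: "finite A" "0 \<notin> A"
  have "A \<subseteq> {1..max0 A}"
  proof
    fix x assume "x \<in> A"
    then show "x \<in> {1..max0 A}" using A by (cases x) (auto simp: max0_def)
  qed
  then show "card A \<le> max0 A" using card_mono[of "{1..max0 A}" A] by simp
qed

lemma max0_le: "A \<subseteq> {1..n} \<Longrightarrow> max0 A \<le> n"
  unfolding max0_def by (subst Max_le_iff) (auto intro: finite_subset)

lemma card_subset_le: "A \<subseteq> {1..n::nat} \<Longrightarrow> card A \<le> n"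
  using card_mono[of "{1..n}" A] by simp

lemma FS_sets_le:
  assumes "A \<subseteq> {1..n}" "B \<subseteq> {1..n}"
  shows "FS_sets A B \<le> 2 * n + 1"
  using max0_le[OF assms(1)] max0_le[OF assms(2)] card_subset_le[OF assms(1)] card_subset_le[OF assms(2)]
  by (auto simp: FS_sets_def)

text \<open>The two expressions differ only if a cardinality exceeds the maximum of the other set,
  or through \<open>max 1\<close> for two empty sets; the \<open>Suc\<close> pays for the
  latter.\<close>

lemma FS_sets_approx:
  assumes "A \<subseteq> {1..n}" "B \<subseteq> {1..n}"
  shows "\<bar>real (FS_sets A B) - (real (max0 A) + real (max0 B) - real (max (card A) (card B)))\<bar>
    \<le> real (Suc (card B) - max0 A) + real (Suc (card A) - max0 B)"
proof -
  have "finite A" "finite B" "0 \<notin> A" "0 \<notin> B" using assms finite_subset by auto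
  then have "card A \<le> max0 A" "card B \<le> max0 B" by (auto intro: card_le_max0)
  then show ?thesis by (auto simp: FS_sets_def max_def)
qed

subsection \<open>Sums over subsets\<close>

lemma sum_Pow_card:
  fixes f :: "nat \<Rightarrow> 'a :: comm_semiring_1"
  shows "(\<Sum>A\<in>Pow {1..n}. f (card A)) = (\<Sum>k\<le>n. of_nat (n choose k) * f k)"
proof -
  have "(\<Sum>A\<in>Pow {1..n}. f (card A)) = (\<Sum>k\<le>n. \<Sum>A | A \<in> Pow {1..n} \<and> card A = k. f (card A))"
    by (rule sum.group[symmetric]) (use card_subset_le[of _ n] in auto)
  also have "\<dots> = (\<Sum>k\<le>n. of_nat (n choose k) * f k)"
  proof (rule sum.cong)
    fix k
    have "(\<Sum>A | A \<in> Pow {1..n} \<and> card A = k. f (card A)) = (\<Sum>A | A \<subseteq> {1..n} \<and> card A = k. f k)"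
      by (intro sum.cong) auto
    also have "\<dots> = of_nat (card {A. A \<subseteq> {1..n} \<and> card A = k}) * f k" by simp
    also have "card {A. A \<subseteq> {1..n} \<and> card A = k} = n choose k"
      by (subst n_subsets) auto
    finally show "(\<Sum>A | A \<in> Pow {1..n} \<and> card A = k. f (card A)) = of_nat (n choose k) * f k" .
  qed simp
  finally show ?thesis .
qed

text \<open>\<open>k - max0 A\<close> counts the j < k with \<open>max0 A \<le> j\<close>, and for
  each such j there are 2^j subsets; this sums to a geometric series.\<close>

lemma sum_Pow_max0:
  assumes "k \<le> Suc n"
  shows "(\<Sum>A\<in>Pow {1..n}. k - max0 A) = 2 ^ k - 1"
proof -
  have count: "card {A \<in> Pow {1..n}. max0 A \<le> j} = 2 ^ j" if "j < k" for j
  proof -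
    have "{A \<in> Pow {1..n}. max0 A \<le> j} = Pow {1..j}"
    proof (intro set_eqI iffI)
      fix A assume A: "A \<in> {A \<in> Pow {1..n}. max0 A \<le> j}"
      then have "finite (insert 0 A)" using finite_subset[of A "{1..n}"] by auto
      then have "x \<le> j" if "x \<in> A" for x
        using A that Max_ge[of "insert 0 A" x] by (auto simp: max0_def)
      then show "A \<in> Pow {1..j}" using A by auto
    next
      fix A assume "A \<in> Pow {1..j}"
      then show "A \<in> {A \<in> Pow {1..n}. max0 A \<le> j}" using max0_le[of A j] that assms by auto
    qed
    then show ?thesis by (simp add: card_Pow)
  qed
  have "(\<Sum>A\<in>Pow {1..n}. k - max0 A) = (\<Sum>A\<in>Pow {1..n}. \<Sum>j<k. if max0 A \<le> j then 1 else 0)"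
  proof (rule sum.cong)
    fix A
    have "(\<Sum>j<k. if max0 A \<le> j then 1 else 0) = card ({..<k} \<inter> {j. max0 A \<le> j})"
      by (simp add: sum.If_cases)
    also have "{..<k} \<inter> {j. max0 A \<le> j} = {max0 A..<k}" by auto
    finally show "k - max0 A = (\<Sum>j<k. if max0 A \<le> j then 1 else 0)" by simp
  qed simp
  also have "\<dots> = (\<Sum>j<k. \<Sum>A\<in>Pow {1..n}. if max0 A \<le> j then 1 else 0)"
    by (rule sum.swap)
  also have "\<dots> = (\<Sum>j<k. 2 ^ j)"
  proof (rule sum.cong)
    fix j assume "j \<in> {..<k}"
    have "(\<Sum>A\<in>Pow {1..n}. if max0 A \<le> j then 1 else 0) = card (Pow {1..n} \<inter> {A. max0 A \<le> j})"
      by (simp add: sum.If_cases)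
    also have "Pow {1..n} \<inter> {A. max0 A \<le> j} = {A \<in> Pow {1..n}. max0 A \<le> j}" by auto
    finally show "(\<Sum>A\<in>Pow {1..n}. if max0 A \<le> j then 1 else 0) = (2::nat) ^ j"
      using count \<open>j \<in> {..<k}\<close> by simp
  qed simp
  also have "\<dots> = 2 ^ k - 1"
    by (induction k) auto
  finally show ?thesis .
qed

lemma sum_Pow_real_max0: "(\<Sum>A\<in>Pow {1..n}. real n - real (max0 A)) = 2 ^ n - 1"
proof -
  have "(\<Sum>A\<in>Pow {1..n}. real n - real (max0 A)) = real (\<Sum>A\<in>Pow {1..n}. n - max0 A)"
    unfolding of_nat_sum by (intro sum.cong) (auto simp: max0_le of_nat_diff)
  also have "\<dots> = 2 ^ n - 1" by (subst sum_Pow_max0) (simp_all add: of_nat_diff)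
  finally show ?thesis .
qed

text \<open>For fixed \<open>B\<close> the sum over \<open>A\<close> is at most twice 2^|B|, and by
  the binomial theorem 2^|B| sums to 3^n. The other half is symmetric.\<close>

lemma sum_Pow_card_max0_error:
  "(\<Sum>A\<in>Pow {1..n}. \<Sum>B\<in>Pow {1..n}. real (Suc (card B) - max0 A) + real (Suc (card A) - max0 B))
    \<le> 4 * 3 ^ n"
proof -
  have 1: "(\<Sum>A\<in>Pow {1..n}. Suc k - max0 A) \<le> 2 * 2 ^ k" if "k \<le> n" for k
    using sum_Pow_max0[of "Suc k" n] that by simp
  have "(\<Sum>B\<in>Pow {1..n}. \<Sum>A\<in>Pow {1..n}. Suc (card B) - max0 A) \<le> (\<Sum>B\<in>Pow {1..n}. 2 * 2 ^ card B)"
    by (intro sum_mono 1 card_subset_le) auto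
  also have "\<dots> = 2 * (\<Sum>k\<le>n. of_nat (n choose k) * 2 ^ k)"
    by (subst sum_Pow_card[of "\<lambda>k. 2 ^ k", symmetric]) (simp add: sum_distrib_left)
  also have "(\<Sum>k\<le>n. of_nat (n choose k) * 2 ^ k) = (3::nat) ^ n"
    using binomial_ring[of "2::nat" 1 n] by simp
  finally have 2: "(\<Sum>B\<in>Pow {1..n}. \<Sum>A\<in>Pow {1..n}. real (Suc (card B) - max0 A)) \<le> 2 * 3 ^ n"
    by (metis (mono_tags, lifting) of_nat_le_iff of_nat_sum of_nat_mult of_nat_power of_nat_numeral sum.cong)
  have "(\<Sum>A\<in>Pow {1..n}. \<Sum>B\<in>Pow {1..n}. real (Suc (card B) - max0 A) + real (Suc (card A) - max0 B)) =
      (\<Sum>A\<in>Pow {1..n}. \<Sum>B\<in>Pow {1..n}. real (Suc (card B) - max0 A)) +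
      (\<Sum>A\<in>Pow {1..n}. \<Sum>B\<in>Pow {1..n}. real (Suc (card A) - max0 B))"
    by (simp only: sum.distrib)
  also have "(\<Sum>A\<in>Pow {1..n}. \<Sum>B\<in>Pow {1..n}. real (Suc (card B) - max0 A)) =
      (\<Sum>B\<in>Pow {1..n}. \<Sum>A\<in>Pow {1..n}. real (Suc (card B) - max0 A))"
    by (rule sum.swap)
  finally show ?thesis using 2 by linarith
qed

section \<open>Mean absolute difference of two cardinalities\<close>

text \<open>By the reflection s -> 2n - s both halves of the sum are equal, and the lower half is a
  weighted partial row sum of binomials with a closed form.\<close>

lemma sum_binomial_abs_deviation:
  "(\<Sum>s\<le>2 * n. real (2 * n choose s) * \<bar>real s - real n\<bar>) = real n * real (2 * n choose n)"
proof (cases n)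
  case (Suc m)
  define g where "g s = (if s \<le> n then real (2 * n choose s) * (real n - real s) else 0)" for s
  have half: "(\<Sum>s\<le>2 * n. g s) = real n / 2 * real (2 * n choose n)"
  proof -
    have "(\<Sum>s\<le>2 * n. g s) = (\<Sum>s\<le>m. g s)"
      using Suc by (intro sum.mono_neutral_right) (auto simp: g_def)
    also have "\<dots> = (\<Sum>s\<le>m. (real (2 * n) gchoose s) * (real (2 * n) / 2 - real s))"
      using Suc by (intro sum.cong) (auto simp: g_def binomial_gbinomial)
    also have "\<dots> = real n / 2 * real (2 * n choose n)"
    proof -
      have "real m + 1 = real n" "m + 1 = n" using Suc by auto
      then show ?thesis by (simp only: gbinomial_partial_row_sum binomial_gbinomial)
    qed
    finally show ?thesis .
  qed
  have "(\<Sum>s\<le>2 * n. g (2 * n - s)) = (\<Sum>s\<le>2 * n. g s)"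
    by (rule sum.reindex_bij_witness[of _ "\<lambda>s. 2 * n - s" "\<lambda>s. 2 * n - s"]) auto
  moreover have "(\<Sum>s\<le>2 * n. real (2 * n choose s) * \<bar>real s - real n\<bar>) =
      (\<Sum>s\<le>2 * n. g s + g (2 * n - s))"
  proof (rule sum.cong)
    fix s assume "s \<in> {..2 * n}"
    then show "real (2 * n choose s) * \<bar>real s - real n\<bar> = g s + g (2 * n - s)"
      using binomial_symmetric[of s "2 * n"] by (auto simp: g_def of_nat_diff)
  qed simp
  ultimately show ?thesis using half by (simp add: sum.distrib)
qed simp

text \<open>Replacing \<open>B\<close> by its complement turns |A| - |B| into |A| + |B| - n; by
  Vandermonde's identity |A| + |B| is distributed like the cardinality of a subset of 2n
  points.\<close>

lemma sum_Pow_abs_card_diff: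
  "(\<Sum>A\<in>Pow {1..n}. \<Sum>B\<in>Pow {1..n}. \<bar>real (card A) - real (card B)\<bar>) = real n * real (2 * n choose n)"
proof -
  let ?c = "\<lambda>k. real (n choose k)"
  have "(\<Sum>A\<in>Pow {1..n}. \<Sum>B\<in>Pow {1..n}. \<bar>real (card A) - real (card B)\<bar>) =
      (\<Sum>A\<in>Pow {1..n}. \<Sum>k\<le>n. ?c k * \<bar>real (card A) - real k\<bar>)"
    by (intro sum.cong refl) (rule sum_Pow_card)
  also have "\<dots> = (\<Sum>j\<le>n. ?c j * (\<Sum>k\<le>n. ?c k * \<bar>real j - real k\<bar>))"
    by (rule sum_Pow_card)
  also have "\<dots> = (\<Sum>j\<le>n. ?c j * (\<Sum>k\<le>n. ?c k * \<bar>real (j + k) - real n\<bar>))"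
  proof (rule sum.cong)
    fix j
    have "(\<Sum>k\<le>n. ?c k * \<bar>real j - real k\<bar>) = (\<Sum>k\<le>n. ?c k * \<bar>real (j + k) - real n\<bar>)"
      by (rule sum.reindex_bij_witness[of _ "\<lambda>k. n - k" "\<lambda>k. n - k"])
         (auto simp: binomial_symmetric[symmetric] of_nat_diff)
    then show "?c j * (\<Sum>k\<le>n. ?c k * \<bar>real j - real k\<bar>) = ?c j * (\<Sum>k\<le>n. ?c k * \<bar>real (j + k) - real n\<bar>)"
      by simp
  qed simp
  also have "\<dots> = (\<Sum>(j, k)\<in>{..n} \<times> {..n}. ?c j * ?c k * \<bar>real (j + k) - real n\<bar>)"
    by (simp add: sum_distrib_left sum.cartesian_product mult.assoc)
  \<comment> \<open>The square is enlarged to a triangle, ready for summation along diagonals; the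
    added binomials are 0.\<close>
  also have "\<dots> = (\<Sum>(j, k)\<in>{(j, k). j + k \<le> 2 * n}. ?c j * ?c k * \<bar>real (j + k) - real n\<bar>)"
    by (rule sum.mono_neutral_left)
       (auto intro: finite_subset[of _ "{..2 * n} \<times> {..2 * n}"] simp: not_le)
  also have "\<dots> = (\<Sum>s\<le>2 * n. \<Sum>j\<le>s. ?c j * ?c (s - j) * \<bar>real (j + (s - j)) - real n\<bar>)"
    by (rule sum.triangle_reindex_eq)
  also have "\<dots> = (\<Sum>s\<le>2 * n. real (2 * n choose s) * \<bar>real s - real n\<bar>)"
  proof (rule sum.cong)
    fix s
    have "(\<Sum>j\<le>s. ?c j * ?c (s - j) * \<bar>real (j + (s - j)) - real n\<bar>) =
        (\<Sum>j\<le>s. ?c j * ?c (s - j) * \<bar>real s - real n\<bar>)"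
      by (intro sum.cong) auto
    also have "\<dots> = (\<Sum>j\<le>s. ?c j * ?c (s - j)) * \<bar>real s - real n\<bar>"
      by (simp only: sum_distrib_right)
    also have "(\<Sum>j\<le>s. ?c j * ?c (s - j)) = real (2 * n choose s)"
      by (simp flip: of_nat_mult of_nat_sum add: vandermonde mult_2)
    finally show "(\<Sum>j\<le>s. ?c j * ?c (s - j) * \<bar>real (j + (s - j)) - real n\<bar>) =
        real (2 * n choose s) * \<bar>real s - real n\<bar>" .
  qed simp
  also have "\<dots> = real n * real (2 * n choose n)" by (rule sum_binomial_abs_deviation)
  finally show ?thesis .
qed

lemma sum_Pow_real_card: "(\<Sum>A\<in>Pow {1..n}. real (card A)) = real n * 2 ^ n / 2"
proof -
  have "(\<Sum>A\<in>Pow {1..n}. real (card A)) = real (\<Sum>k\<le>n. k * (n choose k))"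
    by (subst sum_Pow_card) (simp add: mult.commute)
  also have "\<dots> = real n * 2 ^ n / 2" by (cases n) (simp_all add: choose_linear_sum distrib_right)
  finally show ?thesis .
qed

text \<open>On average \<open>max0\<close> is n - 1 + 2^-n, which twice gives 2n - 2 up to a
  vanishing term. The larger cardinality is half of |A| + |B| + ||A| - |B||, which subtracts n/2 and
  the central binomial term.\<close>

lemma sum_Pow_main_term:
  "(\<Sum>A\<in>Pow {1..n}. \<Sum>B\<in>Pow {1..n}. real (max0 A) + real (max0 B) - real (max (card A) (card B))) =
   4 ^ n * (3 / 2 * real n - 2 + 2 / 2 ^ n) - real n * real (2 * n choose n) / 2"
proof -
  have max0: "(\<Sum>A\<in>Pow {1..n}. real (max0 A)) = 2 ^ n * real n - 2 ^ n + 1"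
    using sum_Pow_real_max0[of n] by (simp add: sum_subtractf card_Pow)
  have p: "(4::real) ^ n = 2 ^ n * 2 ^ n" by (simp flip: power_mult_distrib)
  have m: "real (max a b) = (real a + real b + \<bar>real a - real b\<bar>) / 2" for a b by auto
  have "(\<Sum>A\<in>Pow {1..n}. \<Sum>B\<in>Pow {1..n}. real (max (card A) (card B))) =
      ((\<Sum>A\<in>Pow {1..n}. \<Sum>B\<in>Pow {1..n}. real (card A)) + (\<Sum>A\<in>Pow {1..n}. \<Sum>B\<in>Pow {1..n}. real (card B)) +
       (\<Sum>A\<in>Pow {1..n}. \<Sum>B\<in>Pow {1..n}. \<bar>real (card A) - real (card B)\<bar>)) / 2"
    unfolding m sum_divide_distrib[symmetric] sum.distrib ..
  also have "\<dots> = (4 ^ n * real n + real n * real (2 * n choose n)) / 2"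
    unfolding sum_Pow_abs_card_diff
    by (simp add: sum_Pow_real_card card_Pow p sum_distrib_left[symmetric] sum_distrib_right[symmetric] del: One_nat_def)
  finally have mx: "(\<Sum>A\<in>Pow {1..n}. \<Sum>B\<in>Pow {1..n}. real (max (card A) (card B))) =
      (4 ^ n * real n + real n * real (2 * n choose n)) / 2" .
  have "(\<Sum>A\<in>Pow {1..n}. \<Sum>B\<in>Pow {1..n}. real (max0 A) + real (max0 B) - real (max (card A) (card B))) =
      (\<Sum>A\<in>Pow {1..n}. \<Sum>B\<in>Pow {1..n}. real (max0 A)) + (\<Sum>A\<in>Pow {1..n}. \<Sum>B\<in>Pow {1..n}. real (max0 B))
      - (\<Sum>A\<in>Pow {1..n}. \<Sum>B\<in>Pow {1..n}. real (max (card A) (card B)))"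
    by (simp only: sum.distrib sum_subtractf)
  also have "\<dots> = 2 * (2 ^ n * (2 ^ n * real n - 2 ^ n + 1)) - (4 ^ n * real n + real n * real (2 * n choose n)) / 2"
    unfolding mx by (simp add: max0 card_Pow sum_distrib_left[symmetric] del: One_nat_def)
  also have "\<dots> = 4 ^ n * (3 / 2 * real n - 2 + 2 / 2 ^ n) - real n * real (2 * n choose n) / 2"
    unfolding p by (simp add: field_simps)
  finally show ?thesis .
qed

section \<open>Central binomial coefficients and Wallis' product\<close>

lemma central_binomial_Suc:
  "real (2 * Suc n choose Suc n) / 4 ^ Suc n =
   real (2 * n choose n) / 4 ^ n * (2 * real n + 1) / (2 * real n + 2)"
proof -
  have c: "real (2 * k choose k) = fact (2 * k) / (fact k * fact k)" for k
    using binomial_fact[of k "2 * k", where 'a = real] by (simp add: mult_2)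
  have F: "fact (2 * Suc n) = (2 * real n + 2) * (2 * real n + 1) * fact (2 * n)"
    by (simp add: algebra_simps)
  have f: "fact (Suc n) = (real n + 1) * fact n" by (simp add: algebra_simps)
  have *: "(2 * r + 2) * (2 * r + 1) * F / ((r + 1) * f * ((r + 1) * f)) / (4 * p) =
      F / (f * f) / p * (2 * r + 1) / (2 * r + 2)" if "r + 1 \<noteq> 0" "f \<noteq> 0" "p \<noteq> 0" for r f F p :: real
  proof -
    define s where "s = r + 1"
    have r: "2 * r + 2 = 2 * s" by (simp add: s_def)
    have "s \<noteq> 0" using that by (simp add: s_def)
    then show ?thesis unfolding r s_def[symmetric] using that by (simp add: divide_simps)
  qed
  show ?thesis unfolding c F f power_Suc by (rule *) auto
qed

text \<open>The terms are of order sqrt n and are wanted up to o(1), so the limit of their ratio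
  does not suffice. The reciprocal Wallis products b_n = (2n + 1) a_n^2 decrease and c_n = 2n a_n^2
  increase to 2/pi, which squeezes n a_n between sqrt(n/pi) sqrt(2n/(2n + 1)) and
  sqrt(n/pi).\<close>

lemma central_binomial_asymp:
  "(\<lambda>n. real n * real (2 * n choose n) / 4 ^ n - sqrt (real n) / sqrt pi) \<longlonglongrightarrow> 0"
proof -
  define a where "a n = real (2 * n choose n) / 4 ^ n" for n
  define b where "b n = (2 * real n + 1) * (a n)\<^sup>2" for n
  have a_pos: "a n > 0" for n by (simp add: a_def)
  have a_Suc: "a (Suc n) = a n * (2 * real n + 1) / (2 * real n + 2)" for n
    unfolding a_def by (rule central_binomial_Suc)
  define g where "g k = (4 * real k^2) / (4 * real k^2 - 1)" for k
  have b_wallis: "b n = inverse (\<Prod>k=1..n. g k)" for n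
  proof (induction n)
    case 0
    then show ?case by (simp add: b_def a_def)
  next
    case (Suc n)
    have "b (Suc n) = b n * ((2 * real n + 3) * (2 * real n + 1) / (2 * real n + 2)\<^sup>2)"
      by (simp add: b_def a_Suc power_divide power_mult_distrib power2_eq_square field_simps)
    also have "(2 * real n + 3) * (2 * real n + 1) / (2 * real n + 2)\<^sup>2 =
        inverse (g (Suc n))"
      by (simp add: g_def power2_eq_square field_simps)
    finally show ?case using Suc by (simp add: inverse_mult_distrib mult.commute)
  qed
  have b_lim: "b \<longlonglongrightarrow> 2 / pi"
  proof -
    have "(\<lambda>n. inverse (\<Prod>k=1..n. g k)) \<longlonglongrightarrow> inverse (pi / 2)"
      unfolding g_def by (intro tendsto_inverse wallis) simp
    then show ?thesis by (simp add: b_wallis[abs_def])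
  qed
  have b_ge: "2 / pi \<le> b n" for n
  proof (rule decseq_ge[OF _ b_lim])
    show "decseq b"
    proof (rule decseq_SucI)
      fix n
      have "(2 * real n + 3) * (2 * real n + 1) \<le> (2 * real n + 2)\<^sup>2"
        by (simp add: power2_eq_square algebra_simps)
      then have "(2 * real n + 3) * (2 * real n + 1) / (2 * real n + 2)\<^sup>2 \<le> 1"
        by (simp add: divide_le_eq_1)
      then have "b n * ((2 * real n + 3) * (2 * real n + 1) / (2 * real n + 2)\<^sup>2) \<le> b n * 1"
        by (intro mult_left_mono) (auto simp: b_def)
      also have "b n * ((2 * real n + 3) * (2 * real n + 1) / (2 * real n + 2)\<^sup>2) = b (Suc n)"
        by (simp add: b_def a_Suc power_divide power_mult_distrib power2_eq_square field_simps)
      finally show "b (Suc n) \<le> b n" by simp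
    qed
  qed
  define c where "c n = 2 * real n * (a n)\<^sup>2" for n
  have c_b: "c n = b n * (2 * real n / (2 * real n + 1))" for n
    by (simp add: c_def b_def field_simps)
  have "c \<longlonglongrightarrow> 2 / pi * 1"
    unfolding c_b[abs_def] by (intro tendsto_mult b_lim) real_asymp
  then have c_lim: "c \<longlonglongrightarrow> 2 / pi" by simp
  have c_le: "c n \<le> 2 / pi" for n
  proof (rule incseq_le[OF _ c_lim])
    show "incseq c"
    proof (rule incseq_SucI)
      fix n
      have "c (Suc n) = (a n)\<^sup>2 * ((2 * real n + 1)\<^sup>2 / (2 * real n + 2))"
      proof -
        have "s * (x * t / s)\<^sup>2 = x\<^sup>2 * (t\<^sup>2 / s)" if "s \<noteq> 0" for s t x :: real
          using that by (simp add: power2_eq_square)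
        from this[of "2 * real n + 2" "a n" "2 * real n + 1"] show ?thesis
          by (simp add: c_def a_Suc add.commute)
      qed
      moreover have "2 * real n \<le> (2 * real n + 1)\<^sup>2 / (2 * real n + 2)"
        by (simp add: power2_eq_square field_simps)
      then have "(a n)\<^sup>2 * (2 * real n) \<le> (a n)\<^sup>2 * ((2 * real n + 1)\<^sup>2 / (2 * real n + 2))"
        by (rule mult_left_mono) simp
      ultimately show "c n \<le> c (Suc n)"
        unfolding c_def[of n] by (simp only: mult.commute[of "2 * real n"])
    qed
  qed
  have na: "real n * a n = sqrt (real n / 2 * c n)" for n
  proof -
    have "real n / 2 * c n = (real n * a n)\<^sup>2" by (simp add: c_def power2_eq_square)
    then show ?thesis using a_pos[of n] by simp
  qed
  have upper: "real n * a n \<le> sqrt (real n) / sqrt pi" for n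
  proof -
    have "real n / 2 * c n \<le> real n / 2 * (2 / pi)" by (intro mult_left_mono c_le) simp
    then show ?thesis unfolding na real_sqrt_divide[symmetric] by simp
  qed
  have lower: "sqrt (real n) / sqrt pi * sqrt (2 * real n / (2 * real n + 1)) \<le> real n * a n" for n
  proof -
    have "2 / pi * (2 * real n / (2 * real n + 1)) \<le> c n"
      unfolding c_b by (intro mult_right_mono b_ge) simp
    then have "real n / 2 * (2 / pi * (2 * real n / (2 * real n + 1))) \<le> real n / 2 * c n"
      by (intro mult_left_mono) auto
    then show ?thesis
      unfolding na real_sqrt_divide[symmetric] real_sqrt_mult[symmetric] by simp
  qed
  have low_lim: "(\<lambda>n. sqrt (real n) / sqrt pi * sqrt (2 * real n / (2 * real n + 1)) - sqrt (real n) / sqrt pi) \<longlonglongrightarrow> 0"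
  proof -
    have "(\<lambda>n. 1 / sqrt pi * (sqrt (real n) * sqrt (2 * real n / (2 * real n + 1)) - sqrt (real n))) \<longlonglongrightarrow> 1 / sqrt pi * 0"
      by (intro tendsto_mult tendsto_const) real_asymp
    then show ?thesis by (simp add: field_simps)
  qed
  have "(\<lambda>n. real n * a n - sqrt (real n) / sqrt pi) \<longlonglongrightarrow> 0"
  proof (rule tendsto_sandwich[OF _ _ low_lim tendsto_const])
    show "\<forall>\<^sub>F n in sequentially. real n * a n - sqrt (real n) / sqrt pi \<le> 0"
      using upper by (intro always_eventually) simp
    show "\<forall>\<^sub>F n in sequentially. sqrt (real n) / sqrt pi * sqrt (2 * real n / (2 * real n + 1)) - sqrt (real n) / sqrt pi
        \<le> real n * a n - sqrt (real n) / sqrt pi"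
      using lower by (intro always_eventually) simp
  qed
  then show ?thesis by (simp add: a_def)
qed

subsection \<open>The expectation\<close>

lemma expectation_pmf_of_set:
  fixes f :: "'a \<Rightarrow> 'b :: {banach, second_countable_topology}"
  assumes "finite S" "S \<noteq> {}"
  shows "measure_pmf.expectation (pmf_of_set S) f = (1 / real (card S)) *\<^sub>R (\<Sum>x\<in>S. f x)"
  using assms by (subst integral_measure_pmf[of S]) (auto simp: scaleR_sum_right)

lemma pair_pmf_of_set:
  assumes "finite S" "S \<noteq> {}" "finite T" "T \<noteq> {}"
  shows "pair_pmf (pmf_of_set S) (pmf_of_set T) = pmf_of_set (S \<times> T)"
proof (rule pmf_eqI)
  fix i
  show "pmf (pair_pmf (pmf_of_set S) (pmf_of_set T)) i = pmf (pmf_of_set (S \<times> T)) i"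
    by (cases i) (simp add: assms pmf_pair pmf_of_set card_cartesian_product indicator_def)
qed

text \<open>The two uniform measures differ in total mass by 1 - |T|/|P| on \<open>T\<close>,
  through the rescaling, and by the same amount on the rest of \<open>P\<close>; hence the factor
  2.\<close>

lemma expectation_subset_diff_le:
  fixes \<psi> :: "'a \<Rightarrow> 'b :: {banach, second_countable_topology}"
  assumes "finite P" "T \<subseteq> P" "T \<noteq> {}" "\<And>x. x \<in> P \<Longrightarrow> norm (\<psi> x) \<le> K"
  shows "norm (measure_pmf.expectation (pmf_of_set T) \<psi> - measure_pmf.expectation (pmf_of_set P) \<psi>)
    \<le> 2 * K * (1 - real (card T) / real (card P))"
proof -
  define a b where "a = real (card T)" and "b = real (card P)"
  have fin: "finite T" "P \<noteq> {}" using assms finite_subset by auto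
  have "0 < card T" "card T \<le> card P"
    using assms fin by (auto simp: card_gt_0_iff intro: card_mono)
  then have ab: "0 < a" "a \<le> b" by (auto simp: a_def b_def)
  have cd: "real (card (P - T)) = b - a"
    using assms fin \<open>card T \<le> card P\<close> by (simp add: card_Diff_subset a_def b_def of_nat_diff)
  have bound: "norm (\<Sum>x\<in>S. \<psi> x) \<le> real (card S) * K" if "S \<subseteq> P" for S
    using sum_norm_bound[of S \<psi> K] assms(4) that by auto
  have "(\<Sum>x\<in>P. \<psi> x) = (\<Sum>x\<in>P - T. \<psi> x) + (\<Sum>x\<in>T. \<psi> x)"
    using assms by (intro sum.subset_diff) auto
  then have "measure_pmf.expectation (pmf_of_set T) \<psi> - measure_pmf.expectation (pmf_of_set P) \<psi> =
      (1 / a - 1 / b) *\<^sub>R (\<Sum>x\<in>T. \<psi> x) - (1 / b) *\<^sub>R (\<Sum>x\<in>P - T. \<psi> x)"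
    using assms fin by (simp add: expectation_pmf_of_set a_def[symmetric] b_def[symmetric] algebra_simps)
  also have "norm \<dots> \<le> (1 / a - 1 / b) * (a * K) + (1 / b) * ((b - a) * K)"
  proof (rule order_trans[OF norm_triangle_ineq4 add_mono])
    show "norm ((1 / a - 1 / b) *\<^sub>R (\<Sum>x\<in>T. \<psi> x)) \<le> (1 / a - 1 / b) * (a * K)"
      using ab bound[OF assms(2)] by (simp add: a_def[symmetric] frac_le mult_left_mono)
    show "norm ((1 / b) *\<^sub>R (\<Sum>x\<in>P - T. \<psi> x)) \<le> (1 / b) * ((b - a) * K)"
      using ab bound[of "P - T"] by (simp add: cd divide_right_mono)
  qed
  also have "\<dots> = 2 * K * (1 - a / b)" using ab by (simp add: field_simps)
  finally show ?thesis by (simp add: a_def b_def)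
qed

section \<open>Transfer from permutations to arbitrary subsets\<close>

definition gapped_pair :: "nat \<Rightarrow> (nat set \<times> nat set) pmf" where
  "gapped_pair n = pmf_of_set (gapped_subsets n \<times> gapped_subsets n)"

definition subset_pair :: "nat \<Rightarrow> (nat set \<times> nat set) pmf" where
  "subset_pair n = pmf_of_set (Pow {1..n} \<times> Pow {1..n})"

lemma gapped_subsets_nonempty: "gapped_subsets n \<noteq> {}"
proof -
  have "{} \<in> gapped_subsets n" by (auto simp: gapped_subsets_def)
  then show ?thesis by blast
qed

lemma finite_grassmannian_perms: "finite (grassmannian_perms n)"
  using bij_betw_finite[OF bij_betw_first_values] finite_gapped_subsets by blast

lemma grassmannian_perms_nonempty: "grassmannian_perms n \<noteq> {}"
  using bij_betw_first_values[of n] gapped_subsets_nonempty[of n] by (auto simp: bij_betw_def)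

lemma map_pmf_grassmannian_pair:
  "map_pmf (map_prod first_values first_values) (grassmannian_pair n) = gapped_pair n"
  unfolding grassmannian_pair_def gapped_pair_def
    pair_pmf_of_set[OF finite_grassmannian_perms grassmannian_perms_nonempty
      finite_grassmannian_perms grassmannian_perms_nonempty]
  using finite_grassmannian_perms grassmannian_perms_nonempty
  by (intro map_pmf_of_set_bij_betw bij_betw_map_prod bij_betw_first_values) auto

text \<open>The value type is general so that both the expectation and, with \<open>iexp\<close>,
  the characteristic function are covered.\<close>

lemma expectation_grassmannian_pair:
  fixes \<phi> :: "nat \<Rightarrow> 'b :: {banach, second_countable_topology}"
  shows "measure_pmf.expectation (grassmannian_pair n) (\<lambda>(u, v). \<phi> (FS u v)) =
    measure_pmf.expectation (gapped_pair n) (\<lambda>(A, B). \<phi> (FS_sets A B))"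
proof -
  have set: "set_pmf (grassmannian_pair n) = grassmannian_perms n \<times> grassmannian_perms n"
    using finite_grassmannian_perms grassmannian_perms_nonempty by (simp add: grassmannian_pair_def)
  have "measure_pmf.expectation (grassmannian_pair n) (\<lambda>(u, v). \<phi> (FS u v)) =
      measure_pmf.expectation (grassmannian_pair n) (\<lambda>(u, v). \<phi> (FS_sets (first_values u) (first_values v)))"
    by (intro integral_cong_AE) (auto simp: AE_measure_pmf_iff set FS_eq_FS_sets)
  also have "\<dots> = measure_pmf.expectation (gapped_pair n) (\<lambda>(A, B). \<phi> (FS_sets A B))"
    unfolding map_pmf_grassmannian_pair[symmetric] by (simp add: case_prod_unfold)
  finally show ?thesis .
qed

text \<open>A proportion x = n/2^n of the subsets is excluded, so a pair survives with proportion (1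
  - x)^2 >= 1 - 2x.\<close>

lemma gapped_pair_subset_pair_diff:
  fixes \<psi> :: "nat set \<times> nat set \<Rightarrow> 'b :: {banach, second_countable_topology}"
  assumes "\<And>A B. A \<subseteq> {1..n} \<Longrightarrow> B \<subseteq> {1..n} \<Longrightarrow> norm (\<psi> (A, B)) \<le> K"
  shows "norm (measure_pmf.expectation (gapped_pair n) \<psi> - measure_pmf.expectation (subset_pair n) \<psi>)
    \<le> 4 * K * (real n / 2 ^ n)"
proof -
  define x where "x = real n / 2 ^ n"
  have K: "0 \<le> K" by (rule order_trans[OF norm_ge_zero assms[of "{}" "{}"]]) auto
  have "n \<le> 2 ^ n" using less_exp[of n] by simp
  then have c: "real (card (gapped_subsets n)) = 2 ^ n - real n"
    by (simp add: card_gapped_subsets of_nat_diff)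
  have "real (card (gapped_subsets n \<times> gapped_subsets n)) / real (card (Pow {1..n} \<times> Pow {1..n})) = (1 - x)\<^sup>2"
    by (simp add: card_cartesian_product c card_Pow x_def power2_eq_square field_simps)
  moreover have "norm (measure_pmf.expectation (gapped_pair n) \<psi> - measure_pmf.expectation (subset_pair n) \<psi>)
      \<le> 2 * K * (1 - real (card (gapped_subsets n \<times> gapped_subsets n)) / real (card (Pow {1..n} \<times> Pow {1..n})))"
    unfolding gapped_pair_def subset_pair_def
    by (rule expectation_subset_diff_le)
       (use assms gapped_subsets_nonempty in \<open>auto simp: gapped_subsets_def\<close>)
  moreover have "2 * K * (1 - (1 - x)\<^sup>2) \<le> 2 * K * (2 * x)"
    using K by (intro mult_left_mono) (auto simp: power2_eq_square algebra_simps)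
  ultimately show ?thesis by (simp add: x_def)
qed

lemma expectation_subset_pair:
  fixes \<psi> :: "nat set \<times> nat set \<Rightarrow> 'b :: {banach, second_countable_topology}"
  shows "measure_pmf.expectation (subset_pair n) \<psi> =
    (1 / 4 ^ n) *\<^sub>R (\<Sum>A\<in>Pow {1..n}. \<Sum>B\<in>Pow {1..n}. \<psi> (A, B))"
proof -
  have "real (card (Pow {1..n} \<times> Pow {1..n})) = 4 ^ n"
    by (simp add: card_cartesian_product card_Pow flip: power_mult_distrib)
  then show ?thesis
    unfolding subset_pair_def
    by (subst expectation_pmf_of_set) (auto simp: sum.cartesian_product)
qed

lemma expectation_subset_pair_mono:
  fixes f g :: "nat set \<Rightarrow> nat set \<Rightarrow> real"
  assumes "\<And>A B. A \<subseteq> {1..n} \<Longrightarrow> B \<subseteq> {1..n} \<Longrightarrow> f A B \<le> g A B"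
  shows "measure_pmf.expectation (subset_pair n) (\<lambda>(A, B). f A B) \<le>
    measure_pmf.expectation (subset_pair n) (\<lambda>(A, B). g A B)"
  unfolding expectation_subset_pair using assms
  by (auto intro!: divide_right_mono sum_mono)

lemma integrable_subset_pair [simp]:
  fixes \<psi> :: "nat set \<times> nat set \<Rightarrow> 'b :: {banach, second_countable_topology}"
  shows "integrable (subset_pair n) \<psi>"
  unfolding subset_pair_def by (rule integrable_measure_pmf_finite, subst set_pmf_of_set) auto

lemma subset_pair_approx:
  "measure_pmf.expectation (subset_pair n) (\<lambda>(A, B). \<bar>real (FS_sets A B) -
     (real (max0 A) + real (max0 B) - real (max (card A) (card B)))\<bar>) \<le> 4 * 3 ^ n / 4 ^ n"
proof -
  have "measure_pmf.expectation (subset_pair n) (\<lambda>(A, B). \<bar>real (FS_sets A B) -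
     (real (max0 A) + real (max0 B) - real (max (card A) (card B)))\<bar>) \<le>
     measure_pmf.expectation (subset_pair n) (\<lambda>(A, B). real (Suc (card B) - max0 A) + real (Suc (card A) - max0 B))"
    by (intro expectation_subset_pair_mono FS_sets_approx)
  also have "\<dots> \<le> 4 * 3 ^ n / 4 ^ n"
    unfolding expectation_subset_pair using sum_Pow_card_max0_error[of n]
    by (simp add: divide_right_mono)
  finally show ?thesis .
qed

lemma subset_pair_main_expectation:
  "measure_pmf.expectation (subset_pair n)
     (\<lambda>(A, B). real (max0 A) + real (max0 B) - real (max (card A) (card B))) =
   3 / 2 * real n - 2 + 2 / 2 ^ n - real n * real (2 * n choose n) / 4 ^ n / 2"
  unfolding expectation_subset_pair by (simp only: prod.case sum_Pow_main_term) (simp add: field_simps)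

lemma expectation_FS_asymp:
  "(\<lambda>n. measure_pmf.expectation (grassmannian_pair n) (\<lambda>(u, v). real (FS u v))
     - (3 / 2 * real n - 1 / (2 * sqrt pi) * sqrt (real n) - 2)) \<longlonglongrightarrow> 0"
proof -
  let ?G = "\<lambda>n. measure_pmf.expectation (gapped_pair n) (\<lambda>(A, B). real (FS_sets A B))"
  let ?P = "\<lambda>n. measure_pmf.expectation (subset_pair n) (\<lambda>(A, B). real (FS_sets A B))"
  let ?M = "\<lambda>n. measure_pmf.expectation (subset_pair n)
    (\<lambda>(A, B). real (max0 A) + real (max0 B) - real (max (card A) (card B)))"
  have 1: "(\<lambda>n. ?G n - ?P n) \<longlonglongrightarrow> 0"
  proof (rule Lim_null_comparison)
    show "\<forall>\<^sub>F n in sequentially. norm (?G n - ?P n) \<le> 4 * (2 * real n + 1) * (real n / 2 ^ n)"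
    proof (intro always_eventually allI gapped_pair_subset_pair_diff)
      fix n :: nat and A B :: "nat set" assume "A \<subseteq> {1..n}" "B \<subseteq> {1..n}"
      from FS_sets_le[OF this]
      show "norm (case (A, B) of (A, B) \<Rightarrow> real (FS_sets A B)) \<le> 2 * real n + 1" by simp
    qed
    show "(\<lambda>n. 4 * (2 * real n + 1) * (real n / 2 ^ n)) \<longlonglongrightarrow> 0" by real_asymp
  qed
  have 2: "(\<lambda>n. ?P n - ?M n) \<longlonglongrightarrow> 0"
  proof (rule Lim_null_comparison)
    show "\<forall>\<^sub>F n in sequentially. norm (?P n - ?M n) \<le> 4 * 3 ^ n / 4 ^ n"
    proof (intro always_eventually allI)
      fix n
      have "?P n - ?M n = measure_pmf.expectation (subset_pair n) (\<lambda>(A, B). real (FS_sets A B) -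
          (real (max0 A) + real (max0 B) - real (max (card A) (card B))))"
        by (subst Bochner_Integration.integral_diff[symmetric]) (auto simp: case_prod_unfold)
      also have "norm \<dots> \<le> measure_pmf.expectation (subset_pair n) (\<lambda>x. norm (case x of (A, B) \<Rightarrow> real (FS_sets A B) -
          (real (max0 A) + real (max0 B) - real (max (card A) (card B)))))"
        by (rule integral_norm_bound)
      also have "\<dots> \<le> 4 * 3 ^ n / 4 ^ n"
        using subset_pair_approx[of n] by (simp add: case_prod_unfold)
      finally show "norm (?P n - ?M n) \<le> 4 * 3 ^ n / 4 ^ n" .
    qed
    show "(\<lambda>n. 4 * 3 ^ n / 4 ^ n) \<longlonglongrightarrow> (0::real)" by real_asymp
  qed
  have 3: "(\<lambda>n. ?M n - (3 / 2 * real n - 1 / (2 * sqrt pi) * sqrt (real n) - 2)) \<longlonglongrightarrow> 0"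
  proof -
    have "(\<lambda>n. 2 / 2 ^ n - 1 / 2 * (real n * real (2 * n choose n) / 4 ^ n - sqrt (real n) / sqrt pi))
        \<longlonglongrightarrow> 0 - 1 / 2 * 0"
      by (intro tendsto_diff tendsto_mult tendsto_const central_binomial_asymp) real_asymp
    moreover have "?M n - (3 / 2 * real n - 1 / (2 * sqrt pi) * sqrt (real n) - 2) =
        2 / 2 ^ n - 1 / 2 * (real n * real (2 * n choose n) / 4 ^ n - sqrt (real n) / sqrt pi)" for n
      unfolding subset_pair_main_expectation by (simp add: right_diff_distrib)
    ultimately show ?thesis by simp
  qed
  have "(\<lambda>n. (?G n - ?P n) + (?P n - ?M n) +
      (?M n - (3 / 2 * real n - 1 / (2 * sqrt pi) * sqrt (real n) - 2))) \<longlonglongrightarrow> 0 + 0 + 0"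
    by (intro tendsto_add 1 2 3)
  moreover have "(?G n - ?P n) + (?P n - ?M n) + (?M n - r) = ?G n - r" for n r by simp
  ultimately show ?thesis
    by (simp only: expectation_grassmannian_pair[of _ real] add_0_left)
qed

subsection \<open>The limit distribution\<close>

text \<open>The cardinality of a uniform subset has mean n/2 and standard deviation sqrt n / 2. For
  n = 0 the quotient is 0.\<close>

definition normalized_card :: "nat \<Rightarrow> nat set \<Rightarrow> real" where
  "normalized_card n A = (2 * real (card A) - real n) / sqrt (real n)"

lemma cos_power_asymp:
  "(\<lambda>n. cos (t / sqrt (real n)) ^ n) \<longlonglongrightarrow> exp (- (t\<^sup>2 / 2))" for t :: real
proof -
  \<comment> \<open>The expansion at infinity is carried out for positive t; evenness of the cosine
    covers negative t.\<close>
  have *: "(\<lambda>n. cos (t / sqrt (real n)) ^ n) \<longlonglongrightarrow> exp (- (t * t / 2))" if "t > 0" for t :: real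
    using that by real_asymp
  consider "t > 0" | "t = 0" | "- t > 0" by linarith
  then show ?thesis
  proof cases
    case 3
    then show ?thesis using *[of "- t"] by (simp add: power2_eq_square)
  qed (use *[of t] in \<open>auto simp: power2_eq_square\<close>)
qed

text \<open>With s = t / sqrt n, each point contributes e^(is) if it lies in \<open>A\<close> and
  e^(-is) otherwise, so the binomial theorem gives (2 cos s)^n / 2^n.\<close>

lemma char_normalized_card:
  "char (distr (pmf_of_set (Pow {1..n})) borel (normalized_card n)) t = of_real (cos (t / sqrt (real n)) ^ n)"
proof -
  define s where "s = t / sqrt (real n)"
  define z where "z = exp (\<i> * complex_of_real s)"
  define y where "y = exp (- (\<i> * complex_of_real s))"
  have "char (distr (pmf_of_set (Pow {1..n})) borel (normalized_card n)) t =
      measure_pmf.expectation (pmf_of_set (Pow {1..n})) (\<lambda>A. iexp (t * normalized_card n A))"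
    unfolding char_def by (rule integral_distr) auto
  also have "\<dots> = (1 / 2 ^ n) *\<^sub>R (\<Sum>A\<in>Pow {1..n}. iexp (t * normalized_card n A))"
    by (subst expectation_pmf_of_set) (auto simp: card_Pow)
  also have "(\<Sum>A\<in>Pow {1..n}. iexp (t * normalized_card n A)) =
      (\<Sum>A\<in>Pow {1..n}. z ^ card A * y ^ (n - card A))"
  proof (rule sum.cong)
    fix A assume "A \<in> Pow {1..n}"
    then have c: "card A \<le> n" by (intro card_subset_le) auto
    have e: "t * normalized_card n A = real (card A) * s - real (n - card A) * s"
      using c by (simp add: normalized_card_def s_def of_nat_diff algebra_simps flip: diff_divide_distrib add_divide_distrib)
    then have "\<i> * complex_of_real (t * normalized_card n A) =
        of_nat (card A) * (\<i> * complex_of_real s) + of_nat (n - card A) * (- (\<i> * complex_of_real s))"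
      unfolding e by (simp add: algebra_simps)
    then show "iexp (t * normalized_card n A) = z ^ card A * y ^ (n - card A)"
      unfolding z_def y_def by (simp only: exp_add exp_of_nat_mult)
  qed simp
  also have "\<dots> = (z + y) ^ n"
    by (subst sum_Pow_card[of "\<lambda>k. z ^ k * y ^ (n - k)"]) (simp add: binomial_ring mult.assoc)
  also have "z + y = 2 * of_real (cos s)"
    by (simp add: z_def y_def cos_exp_eq flip: cos_of_real)
  also have "(1 / 2 ^ n) *\<^sub>R (2 * complex_of_real (cos s)) ^ n = of_real (cos s ^ n)"
    by (simp add: power_mult_distrib scaleR_conv_of_real)
  finally show ?thesis by (simp add: s_def)
qed

lemma normalized_card_weak_conv:
  "weak_conv_m (\<lambda>n. distr (pmf_of_set (Pow {1..n})) borel (normalized_card n)) std_normal_distribution"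
proof (rule levy_continuity)
  show "real_distribution (distr (pmf_of_set (Pow {1..n})) borel (normalized_card n))" for n
    by (intro prob_space.real_distribution_distr measure_pmf.prob_space_axioms) simp
  show "(\<lambda>n. char (distr (pmf_of_set (Pow {1..n})) borel (normalized_card n)) t)
      \<longlonglongrightarrow> char std_normal_distribution t" for t
    unfolding char_normalized_card char_std_normal_distribution
    using tendsto_of_real[OF cos_power_asymp[of t]] by simp
qed (rule real_dist_normal_dist)

text \<open>Open half-lines are what the law of the maximum requires; weak convergence reaches them
  because the boundary point is a null set.\<close>

lemma std_normal_lessThan_lim:
  "(\<lambda>n. measure (pmf_of_set (Pow {1..n})) {A. normalized_card n A < x})
    \<longlonglongrightarrow> measure std_normal_distribution {..<x}"
proof -
  have "emeasure std_normal_distribution {x} = 0"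
  proof -
    have "{x} \<in> null_sets lborel" by (rule finite_imp_null_set_lborel) simp
    moreover have "absolutely_continuous lborel std_normal_distribution"
      by (rule absolutely_continuousI_density) simp
    ultimately show ?thesis unfolding absolutely_continuous_def by (blast dest: null_setsD1)
  qed
  then have "(\<lambda>n. measure (distr (pmf_of_set (Pow {1..n})) borel (normalized_card n)) {..<x})
      \<longlonglongrightarrow> measure std_normal_distribution {..<x}"
    by (intro weak_conv_imp_continuity_set_conv[OF _ _ normalized_card_weak_conv]
        prob_space.real_distribution_distr measure_pmf.prob_space_axioms real_dist_normal_dist) auto
  then show ?thesis by (simp add: measure_distr vimage_def)
qed

section \<open>The law of the maximum\<close>

definition limit_distribution :: "real measure" where
  "limit_distribution = distr (std_normal_distribution \<Otimes>\<^sub>M std_normal_distribution) borel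
    (\<lambda>(z1, z2). - (1 / 2) * max z1 z2)"

lemma real_distribution_limit: "real_distribution limit_distribution"
proof -
  interpret N: real_distribution std_normal_distribution by (rule real_dist_normal_dist)
  interpret P: pair_prob_space std_normal_distribution std_normal_distribution ..
  show ?thesis
    unfolding limit_distribution_def
    by (intro prob_space.real_distribution_distr P.prob_space_axioms) measurable
qed

text \<open>The event -max(z1, z2)/2 <= x fails exactly if both variables are below -2x, and by
  independence this has the probability of a square.\<close>

lemma cdf_limit_distribution:
  "cdf limit_distribution x = 1 - (measure std_normal_distribution {..<- 2 * x})\<^sup>2"
proof -
  interpret N: real_distribution std_normal_distribution by (rule real_dist_normal_dist)
  interpret P: pair_prob_space std_normal_distribution std_normal_distribution ..
  let ?NN = "std_normal_distribution \<Otimes>\<^sub>M std_normal_distribution"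
  let ?Q = "{..<- 2 * x} \<times> {..<- 2 * x}"
  have sp: "space ?NN = UNIV" by (simp add: space_pair_measure)
  have "cdf limit_distribution x = measure ?NN ((\<lambda>(z1, z2). - (1 / 2) * max z1 z2) -` {..x} \<inter> space ?NN)"
    unfolding limit_distribution_def cdf_def by (rule measure_distr) measurable
  also have "(\<lambda>(z1, z2). - (1 / 2) * max z1 z2) -` {..x} \<inter> space ?NN = space ?NN - ?Q"
    unfolding sp by auto
  also have "measure ?NN (space ?NN - ?Q) = 1 - measure ?NN ?Q"
    by (rule P.prob_compl) (simp add: pair_measureI)
  also have "emeasure ?NN ?Q = emeasure std_normal_distribution {..<- 2 * x} * emeasure std_normal_distribution {..<- 2 * x}"
    by (rule N.emeasure_pair_measure_Times) simp_all
  then have "measure ?NN ?Q = (measure std_normal_distribution {..<- 2 * x})\<^sup>2"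
    by (simp add: measure_def enn2real_mult power2_eq_square)
  finally show ?thesis .
qed

definition max_statistic :: "nat \<Rightarrow> nat set \<times> nat set \<Rightarrow> real" where
  "max_statistic n = (\<lambda>(A, B). - (1 / 2) * max (normalized_card n A) (normalized_card n B))"

text \<open>As for the limit, the distribution function is one minus the square of a probability for
  a single set, so the limit law of one cardinality suffices, at every x.\<close>

lemma max_statistic_weak_conv:
  "weak_conv_m (\<lambda>n. distr (subset_pair n) borel (max_statistic n)) limit_distribution"
  unfolding weak_conv_m_def weak_conv_def
proof (intro allI impI)
  fix x
  have "cdf (distr (subset_pair n) borel (max_statistic n)) x =
      1 - (measure (pmf_of_set (Pow {1..n})) {A. normalized_card n A < - 2 * x})\<^sup>2" for n
  proof -
    let ?Q = "{A. normalized_card n A < - 2 * x}"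
    have "cdf (distr (subset_pair n) borel (max_statistic n)) x =
        measure (subset_pair n) (max_statistic n -` {..x} \<inter> space (subset_pair n))"
      unfolding cdf_def by (rule measure_distr) auto
    also have "max_statistic n -` {..x} \<inter> space (subset_pair n) = space (subset_pair n) - ?Q \<times> ?Q"
      by (auto simp: max_statistic_def)
    also have "measure (subset_pair n) (space (subset_pair n) - ?Q \<times> ?Q) = 1 - measure (subset_pair n) (?Q \<times> ?Q)"
      by (rule measure_pmf.prob_compl) simp
    also have "measure (subset_pair n) (?Q \<times> ?Q) = (measure (pmf_of_set (Pow {1..n})) ?Q)\<^sup>2"
    proof -
      have "(Pow {1..n} \<times> Pow {1..n}) \<inter> (?Q \<times> ?Q) = (Pow {1..n} \<inter> ?Q) \<times> (Pow {1..n} \<inter> ?Q)" by auto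
      then have "measure (subset_pair n) (?Q \<times> ?Q) =
          real (card (Pow {1..n} \<inter> ?Q) * card (Pow {1..n} \<inter> ?Q)) / real (card (Pow {1..n}) * card (Pow {1..n}))"
        unfolding subset_pair_def
        by (subst measure_pmf_of_set) (simp_all only: card_cartesian_product, auto)
      moreover have "measure (pmf_of_set (Pow {1..n})) ?Q = real (card (Pow {1..n} \<inter> ?Q)) / real (card (Pow {1..n}))"
        by (rule measure_pmf_of_set) auto
      ultimately show ?thesis by (simp only: power2_eq_square of_nat_mult times_divide_times_eq)
    qed
    finally show ?thesis .
  qed
  then show "(\<lambda>n. cdf (distr (subset_pair n) borel (max_statistic n)) x) \<longlonglongrightarrow> cdf limit_distribution x"
    unfolding cdf_limit_distribution
    by (simp only:) (intro tendsto_diff tendsto_const tendsto_power std_normal_lessThan_lim)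
qed

section \<open>Comparison of characteristic functions\<close>

lemma norm_iexp_diff_le: "norm (iexp a - iexp b) \<le> \<bar>a - b\<bar>"
proof -
  have "iexp a - iexp b = iexp b * (iexp (a - b) - 1)"
    by (simp add: algebra_simps flip: exp_add)
  moreover have "norm (iexp (a - b) - 1) \<le> \<bar>a - b\<bar>"
    using iexp_approx1[of "a - b" 0] by simp
  ultimately show ?thesis by (simp add: norm_mult)
qed

lemma normalized_FS_sets_close:
  "measure_pmf.expectation (subset_pair n)
     (\<lambda>(A, B). \<bar>(real (FS_sets A B) - 3 / 2 * real n) / sqrt (real n) - max_statistic n (A, B)\<bar>)
   \<le> 6 / sqrt (real n)"
proof -
  let ?h = "\<lambda>A B. real (max0 A) + real (max0 B) - real (max (card A) (card B))"
  let ?g = "\<lambda>A B. \<bar>real (FS_sets A B) - ?h A B\<bar> + (real n - real (max0 A)) + (real n - real (max0 B))"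
  have le: "\<bar>(real (FS_sets A B) - 3 / 2 * real n) / sqrt (real n) - max_statistic n (A, B)\<bar> \<le> ?g A B / sqrt (real n)"
    if "A \<subseteq> {1..n}" "B \<subseteq> {1..n}" for A B
  proof -
    have "max_statistic n (A, B) = (real n / 2 - real (max (card A) (card B))) / sqrt (real n)"
    proof (cases "n = 0")
      case False
      then have "max (normalized_card n A) (normalized_card n B) =
          (2 * real (max (card A) (card B)) - real n) / sqrt (real n)"
        by (cases "card A \<le> card B") (auto simp: normalized_card_def max_def divide_le_cancel)
      then show ?thesis by (simp add: max_statistic_def diff_divide_distrib right_diff_distrib)
    qed (simp add: max_statistic_def normalized_card_def)
    then have "(real (FS_sets A B) - 3 / 2 * real n) / sqrt (real n) - max_statistic n (A, B) =
        ((real (FS_sets A B) - ?h A B) - (real n - real (max0 A)) - (real n - real (max0 B))) / sqrt (real n)"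
      by (simp add: diff_divide_distrib[symmetric] algebra_simps)
    moreover have "max0 A \<le> n" "max0 B \<le> n" using that by (auto intro!: max0_le)
    ultimately show ?thesis
      by (simp only: abs_divide abs_of_nonneg real_sqrt_ge_zero of_nat_0_le_iff)
         (intro divide_right_mono, auto)
  qed
  have "measure_pmf.expectation (subset_pair n)
     (\<lambda>(A, B). \<bar>(real (FS_sets A B) - 3 / 2 * real n) / sqrt (real n) - max_statistic n (A, B)\<bar>)
     \<le> measure_pmf.expectation (subset_pair n) (\<lambda>(A, B). ?g A B / sqrt (real n))"
    by (intro expectation_subset_pair_mono le)
  also have "\<dots> = (measure_pmf.expectation (subset_pair n) (\<lambda>(A, B). \<bar>real (FS_sets A B) - ?h A B\<bar>) +
      measure_pmf.expectation (subset_pair n) (\<lambda>(A, B). real n - real (max0 A)) +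
      measure_pmf.expectation (subset_pair n) (\<lambda>(A, B). real n - real (max0 B))) / sqrt (real n)"
    by (subst Bochner_Integration.integral_add[symmetric], simp, simp)+ (simp add: case_prod_unfold)
  \<comment> \<open>4 bounds the error 4 (3/4)^n of the simplified formula; each 1 bounds the mean 1
    - 2^-n of n - max.\<close>
  also have "\<dots> \<le> (4 + 1 + 1) / sqrt (real n)"
  proof (intro divide_right_mono add_mono)
    have "4 * 3 ^ n / 4 ^ n \<le> (4::real)" by (simp add: divide_le_eq power_mono)
    then show "measure_pmf.expectation (subset_pair n) (\<lambda>(A, B). \<bar>real (FS_sets A B) - ?h A B\<bar>) \<le> 4"
      using subset_pair_approx[of n] by linarith
    have p: "(4::real) ^ n = 2 ^ n * 2 ^ n" by (simp flip: power_mult_distrib)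
    have "(\<Sum>A\<in>Pow {1..n}. \<Sum>B\<in>Pow {1..n}. real n - real (max0 B)) \<le> 4 ^ n"
      unfolding sum_Pow_real_max0 p by (simp add: card_Pow algebra_simps)
    moreover have "(\<Sum>A\<in>Pow {1..n}. \<Sum>B\<in>Pow {1..n}. real n - real (max0 A)) =
        (\<Sum>A\<in>Pow {1..n}. \<Sum>B\<in>Pow {1..n}. real n - real (max0 B))"
      by (rule sum.swap)
    ultimately show "measure_pmf.expectation (subset_pair n) (\<lambda>(A, B). real n - real (max0 A)) \<le> 1"
      "measure_pmf.expectation (subset_pair n) (\<lambda>(A, B). real n - real (max0 B)) \<le> 1"
      unfolding expectation_subset_pair by (simp_all only: prod.case) (simp_all add: divide_le_eq)
  qed simp
  finally show ?thesis by simp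
qed

text \<open>Slutsky's argument for characteristic functions: \<open>iexp\<close> has norm 1, which
  absorbs the excluded subsets, and is 1-Lipschitz, which turns the mean distance to
  \<open>max_statistic\<close> into a bound. Levy's theorem translates in both directions.\<close>

lemma normalized_FS_weak_conv:
  "weak_conv_m (\<lambda>n. distr (grassmannian_pair n) borel (\<lambda>(u, v). (real (FS u v) - 3 / 2 * real n) / sqrt (real n)))
    limit_distribution"
proof (rule levy_continuity[OF _ real_distribution_limit])
  show "real_distribution (distr (grassmannian_pair n) borel
      (\<lambda>(u, v). (real (FS u v) - 3 / 2 * real n) / sqrt (real n)))" for n
    by (intro prob_space.real_distribution_distr measure_pmf.prob_space_axioms) simp
  fix t
  let ?f = "\<lambda>n k. (real k - 3 / 2 * real n) / sqrt (real n)"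
  let ?G = "\<lambda>n. measure_pmf.expectation (gapped_pair n) (\<lambda>(A, B). iexp (t * ?f n (FS_sets A B)))"
  let ?P = "\<lambda>n. measure_pmf.expectation (subset_pair n) (\<lambda>(A, B). iexp (t * ?f n (FS_sets A B)))"
  let ?Y = "\<lambda>n. measure_pmf.expectation (subset_pair n) (\<lambda>x. iexp (t * max_statistic n x))"
  have char_G: "char (distr (grassmannian_pair n) borel (\<lambda>(u, v). ?f n (FS u v))) t = ?G n" for n
  proof -
    have "char (distr (grassmannian_pair n) borel (\<lambda>(u, v). ?f n (FS u v))) t =
        measure_pmf.expectation (grassmannian_pair n) (\<lambda>(u, v). iexp (t * ?f n (FS u v)))"
      unfolding char_def by (subst integral_distr) (auto simp: case_prod_unfold)
    then show ?thesis by (simp only: expectation_grassmannian_pair[of n "\<lambda>k. iexp (t * ?f n k)"])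
  qed
  have 1: "(\<lambda>n. ?G n - ?P n) \<longlonglongrightarrow> 0"
  proof (rule Lim_null_comparison)
    show "\<forall>\<^sub>F n in sequentially. norm (?G n - ?P n) \<le> 4 * 1 * (real n / 2 ^ n)"
      by (intro always_eventually allI gapped_pair_subset_pair_diff) simp
    show "(\<lambda>n. 4 * 1 * (real n / 2 ^ n)) \<longlonglongrightarrow> 0" by real_asymp
  qed
  have 2: "(\<lambda>n. ?P n - ?Y n) \<longlonglongrightarrow> 0"
  proof (rule Lim_null_comparison)
    show "\<forall>\<^sub>F n in sequentially. norm (?P n - ?Y n) \<le> \<bar>t\<bar> * (6 / sqrt (real n))"
    proof (intro always_eventually allI)
      fix n
      have "?P n - ?Y n = measure_pmf.expectation (subset_pair n)
          (\<lambda>(A, B). iexp (t * ?f n (FS_sets A B)) - iexp (t * max_statistic n (A, B)))"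
        by (subst Bochner_Integration.integral_diff[symmetric]) (auto simp: case_prod_unfold)
      also have "norm \<dots> \<le> measure_pmf.expectation (subset_pair n)
          (\<lambda>x. norm (case x of (A, B) \<Rightarrow> iexp (t * ?f n (FS_sets A B)) - iexp (t * max_statistic n (A, B))))"
        by (rule integral_norm_bound)
      also have "\<dots> = measure_pmf.expectation (subset_pair n)
          (\<lambda>(A, B). norm (iexp (t * ?f n (FS_sets A B)) - iexp (t * max_statistic n (A, B))))"
        by (simp add: case_prod_unfold)
      also have "\<dots> \<le> measure_pmf.expectation (subset_pair n)
          (\<lambda>(A, B). \<bar>t\<bar> * \<bar>?f n (FS_sets A B) - max_statistic n (A, B)\<bar>)"
      proof (rule expectation_subset_pair_mono)
        fix A B
        show "norm (iexp (t * ?f n (FS_sets A B)) - iexp (t * max_statistic n (A, B)))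
            \<le> \<bar>t\<bar> * \<bar>?f n (FS_sets A B) - max_statistic n (A, B)\<bar>"
          using norm_iexp_diff_le[of "t * ?f n (FS_sets A B)" "t * max_statistic n (A, B)"]
          by (simp only: right_diff_distrib[symmetric] abs_mult)
      qed
      also have "\<dots> = \<bar>t\<bar> * measure_pmf.expectation (subset_pair n)
          (\<lambda>(A, B). \<bar>?f n (FS_sets A B) - max_statistic n (A, B)\<bar>)"
        by (simp add: case_prod_unfold)
      also have "\<dots> \<le> \<bar>t\<bar> * (6 / sqrt (real n))"
        by (intro mult_left_mono normalized_FS_sets_close) simp
      finally show "norm (?P n - ?Y n) \<le> \<bar>t\<bar> * (6 / sqrt (real n))" .
    qed
    have "(\<lambda>n. \<bar>t\<bar> * (6 / sqrt (real n))) \<longlonglongrightarrow> \<bar>t\<bar> * 0"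
      by (intro tendsto_mult tendsto_const) real_asymp
    then show "(\<lambda>n. \<bar>t\<bar> * (6 / sqrt (real n))) \<longlonglongrightarrow> 0" by simp
  qed
  have 3: "?Y \<longlonglongrightarrow> char limit_distribution t"
  proof -
    have "(\<lambda>n. char (distr (subset_pair n) borel (max_statistic n)) t) \<longlonglongrightarrow> char limit_distribution t"
      by (intro levy_continuity1 max_statistic_weak_conv real_distribution_limit
          prob_space.real_distribution_distr measure_pmf.prob_space_axioms) simp
    moreover have "char (distr (subset_pair n) borel (max_statistic n)) t = ?Y n" for n
      unfolding char_def by (rule integral_distr) auto
    ultimately show ?thesis by simp
  qed
  have "(\<lambda>n. (?G n - ?P n) + (?P n - ?Y n) + ?Y n) \<longlonglongrightarrow> 0 + 0 + char limit_distribution t"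
    by (intro tendsto_add 1 2 3)
  moreover have "(?G n - ?P n) + (?P n - ?Y n) + ?Y n = ?G n" for n by simp
  ultimately show "(\<lambda>n. char (distr (grassmannian_pair n) borel (\<lambda>(u, v). ?f n (FS u v))) t)
      \<longlonglongrightarrow> char limit_distribution t"
    by (simp only: char_G add_0_left)
qed

theorem theorem1p3:
  shows "((\<lambda>n. measure_pmf.expectation (grassmannian_pair n) (\<lambda>(u, v). real (FS u v))
            - (3 / 2 * real n - 1 / (2 * sqrt pi) * sqrt (real n) - 2)) \<longlonglongrightarrow> 0)
    \<and> weak_conv_m
        (\<lambda>n. distr (measure_pmf (grassmannian_pair n)) borel
               (\<lambda>(u, v). (real (FS u v) - 3 / 2 * real n) / sqrt (real n)))
        (distr (std_normal_distribution \<Otimes>\<^sub>M std_normal_distribution) borel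
               (\<lambda>(z1, z2). - (1 / 2) * max z1 z2))"
  using expectation_FS_asymp normalized_FS_weak_conv unfolding limit_distribution_def by (rule conjI)

end
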